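(* Let $G$ be an amenable locally compact group. If $\Gamma<G$ is a uniform lattice (that is, a lattice with $G/\Gamma$ compact), then the map $\iota:\mathrm{LIM}(\Gamma)\to\mathrm{TLIM}(G)$ is surjective.
   Context: All groups are Hausdorff. $G$ is amenable if $L_\infty(G)$ admits a left-invariant mean. A lattice in $G$ is a discrete subgroup $\Gamma$ such that $G/\Gamma$ carries a $G$-invariant Radon probability measure $\lambda$ (which is then unique). Write $(L_xf)(y)=f(xy)$. $\mathrm{LUC}(G)$ is the Banach algebra (sup norm) of bounded continuous functions $f$ on $G$ with $\lim_{x\to e}\|f-L_xf\|_\infty=0$. A mean on a space of bounded functions containing the constants is a positive linear functional $m$ with $m(1)=1$; it is left-invariant if $m(L_xf)=m(f)$ for all $f$ and $x$. $\mathrm{LIM}(\Gamma)$ is the set of left-invariant means on $\ell_\infty(\Gamma)$. $\mathrm{TLIM}(G)$ is the set of topological left-invariant means on $L_\infty(G)$, i.e. means $\mu$ with $\mu(f*\phi)=\mu(\phi)$ for all $\phi\in L_\infty(G)$ and $f\in L_1(G)$ with $f\ge0$, $\|f\|_1=1$; it is identified, via restriction (a bijection), with the set $\mathrm{LIM}(\mathrm{LUC}(G))$ of left-invariant means on $\mathrm{LUC}(G)$. For $m\in\mathrm{LIM}(\Gamma)$ and $f\in\mathrm{LUC}(G)$, let $P_mf(x\Gamma)=\langle m,(L_xf)|_\Gamma\rangle$, a well-defined bounded continuous function on $G/\Gamma$. The map $\iota$ is defined by $$\iota m(f)=\int_{G/\Gamma}P_mf\,d\lambda,\qquad f\in\mathrm{LUC}(G).$$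 *)

theory Defs
  imports "HOL-Analysis.Analysis" "HOL-Library.Nonpos_Ints"
begin

text \<open>
  Groups are written additively, as the library's topological groups are, but they are not assumed
  commutative: \<open>x + y\<close> is the product $xy$, \<open>0\<close> the identity, \<open>- x\<close> the inverse of \<open>x\<close>.
  All function spaces are complex. Functions on a subset, and functionals on a function space, are
  extensional (\<open>undefined\<close> off their domain), so that equality of functionals is equality on their
  domain. On \<open>X = UNIV\<close> restriction is the identity.
\<close>

section \<open>Radon measures and Haar measure\<close>

definition radon_measure :: "'a topology \<Rightarrow> 'a measure \<Rightarrow> bool" where
  "radon_measure T M \<longleftrightarrow>
     space M = topspace T \<and>
     sets M = sigma_sets (topspace T) {U. openin T U} \<and>
     (\<forall>K. compactin T K \<longrightarrow> emeasure M K < \<infinity>) \<and>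
     (\<forall>B\<in>sets M. emeasure M B = (INF U\<in>{U. openin T U \<and> B \<subseteq> U}. emeasure M U)) \<and>
     (\<forall>U. openin T U \<longrightarrow> emeasure M U = (SUP K\<in>{K. compactin T K \<and> K \<subseteq> U}. emeasure M K))"

definition left_haar_measure :: "'g::{topological_group_add,t2_space} measure \<Rightarrow> bool" where
  "left_haar_measure H \<longleftrightarrow>
     radon_measure euclidean H \<and> emeasure H UNIV \<noteq> 0 \<and>
     (\<forall>x. \<forall>B\<in>sets H. emeasure H ((+) x ` B) = emeasure H B)"

section \<open>Means\<close>

definition is_mean :: "'a set \<Rightarrow> ('a \<Rightarrow> complex) set \<Rightarrow> (('a \<Rightarrow> complex) \<Rightarrow> complex) \<Rightarrow> bool" where
  "is_mean X V m \<longleftrightarrow>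
     m \<in> extensional V \<and>
     (\<forall>f\<in>V. \<forall>g\<in>V. m (\<lambda>x\<in>X. f x + g x) = m f + m g) \<and>
     (\<forall>c. \<forall>f\<in>V. m (\<lambda>x\<in>X. c * f x) = c * m f) \<and>
     (\<forall>f\<in>V. (\<forall>x\<in>X. f x \<in> \<real>\<^sub>\<ge>\<^sub>0) \<longrightarrow> m f \<in> \<real>\<^sub>\<ge>\<^sub>0) \<and>
     m (\<lambda>x\<in>X. 1) = 1"

definition left_invariant_on ::
    "'g::group_add set \<Rightarrow> ('g \<Rightarrow> complex) set \<Rightarrow> (('g \<Rightarrow> complex) \<Rightarrow> complex) \<Rightarrow> bool" where
  "left_invariant_on X V m \<longleftrightarrow> (\<forall>f\<in>V. \<forall>x\<in>X. m (\<lambda>y\<in>X. f (x + y)) = m f)"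

definition left_invariant_means ::
    "'g::group_add set \<Rightarrow> ('g \<Rightarrow> complex) set \<Rightarrow> (('g \<Rightarrow> complex) \<Rightarrow> complex) set" where
  "left_invariant_means X V = {m. is_mean X V m \<and> left_invariant_on X V m}"

definition linf :: "'a set \<Rightarrow> ('a \<Rightarrow> complex) set" where
  "linf X = {h \<in> extensional X. bounded (h ` X)}"

definition LUC :: "('g::{topological_group_add,t2_space} \<Rightarrow> complex) set" where
  "LUC = {f. continuous_on UNIV f \<and> bounded (range f) \<and>
             ((\<lambda>x. SUP y. norm (f y - f (x + y))) \<longlongrightarrow> 0) (at 0)}"

text \<open>
  Since the group need not be \<open>\<sigma>\<close>-compact, $L_\infty$ is taken in the sense that makes it the dual of
  $L_1$: locally measurable functions modulo equality locally almost everywhere. \<open>Linf H\<close> consists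
  of the everywhere bounded representatives (each class has one), and functionals
  on the quotient are functionals on \<open>Linf H\<close> that do not distinguish representatives of the same class.
\<close>

definition Linf :: "'a measure \<Rightarrow> ('a \<Rightarrow> complex) set" where
  "Linf H = {\<phi>. bounded (range \<phi>) \<and>
     (\<forall>F\<in>sets H. emeasure H F < \<infinity> \<longrightarrow> \<phi> \<in> borel_measurable (restrict_space H F))}"

definition locally_ae_eq :: "'a measure \<Rightarrow> ('a \<Rightarrow> complex) \<Rightarrow> ('a \<Rightarrow> complex) \<Rightarrow> bool" where
  "locally_ae_eq H \<phi> \<psi> \<longleftrightarrow>
     (\<forall>F\<in>sets H. emeasure H F < \<infinity> \<longrightarrow> (AE x in H. x \<in> F \<longrightarrow> \<phi> x = \<psi> x))"

definition is_mean_Linf :: "'a measure \<Rightarrow> (('a \<Rightarrow> complex) \<Rightarrow> complex) \<Rightarrow> bool" where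
  "is_mean_Linf H m \<longleftrightarrow> is_mean UNIV (Linf H) m \<and>
     (\<forall>\<phi>\<in>Linf H. \<forall>\<psi>\<in>Linf H. locally_ae_eq H \<phi> \<psi> \<longrightarrow> m \<phi> = m \<psi>)"

definition amenable :: "'g::{topological_group_add,t2_space} measure \<Rightarrow> bool" where
  "amenable H \<longleftrightarrow> (\<exists>m. is_mean_Linf H m \<and> left_invariant_on UNIV (Linf H) m)"

text \<open>$(f * \phi)(x) = \int f(y)\, \phi(y^{-1}x)\, dy$.\<close>

definition convolution ::
    "'g::{topological_group_add,t2_space} measure \<Rightarrow> ('g \<Rightarrow> real) \<Rightarrow> ('g \<Rightarrow> complex) \<Rightarrow> 'g \<Rightarrow> complex" where
  "convolution H f \<phi> x = (LINT y|H. complex_of_real (f y) * \<phi> (- y + x))"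

definition TLIM ::
    "'g::{topological_group_add,t2_space} measure \<Rightarrow> (('g \<Rightarrow> complex) \<Rightarrow> complex) set" where
  "TLIM H = {\<mu>. is_mean_Linf H \<mu> \<and>
     (\<forall>\<phi>\<in>Linf H. \<forall>f. integrable H f \<and> (\<forall>y. 0 \<le> f y) \<and> integral\<^sup>L H f = 1
        \<longrightarrow> \<mu> (convolution H f \<phi>) = \<mu> \<phi>)}"

section \<open>Lattices\<close>

definition add_subgroup :: "'g::group_add set \<Rightarrow> bool" where
  "add_subgroup \<Gamma> \<longleftrightarrow> 0 \<in> \<Gamma> \<and> (\<forall>x\<in>\<Gamma>. \<forall>y\<in>\<Gamma>. x + y \<in> \<Gamma>) \<and> (\<forall>x\<in>\<Gamma>. - x \<in> \<Gamma>)"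

definition left_coset :: "'g::group_add set \<Rightarrow> 'g \<Rightarrow> 'g set" where
  "left_coset \<Gamma> x = (+) x ` \<Gamma>"

definition coset_topology :: "'g::{topological_group_add,t2_space} set \<Rightarrow> 'g set topology" where
  "coset_topology \<Gamma> =
     topology (\<lambda>\<U>. \<U> \<subseteq> range (left_coset \<Gamma>) \<and> open {x. left_coset \<Gamma> x \<in> \<U>})"

lemma openin_coset_topology:
  "openin (coset_topology \<Gamma>) \<U> \<longleftrightarrow> \<U> \<subseteq> range (left_coset \<Gamma>) \<and> open {x. left_coset \<Gamma> x \<in> \<U>}"
proof -
  have "istopology (\<lambda>\<U>. \<U> \<subseteq> range (left_coset \<Gamma>) \<and> open {x. left_coset \<Gamma> x \<in> \<U>})"
    unfolding istopology_def
  proof (rule conjI; intro allI impI)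
    fix S T
    assume S: "S \<subseteq> range (left_coset \<Gamma>) \<and> open {x. left_coset \<Gamma> x \<in> S}"
      and T: "T \<subseteq> range (left_coset \<Gamma>) \<and> open {x. left_coset \<Gamma> x \<in> T}"
    have "{x. left_coset \<Gamma> x \<in> S \<inter> T} = {x. left_coset \<Gamma> x \<in> S} \<inter> {x. left_coset \<Gamma> x \<in> T}"
      by auto
    then show "S \<inter> T \<subseteq> range (left_coset \<Gamma>) \<and> open {x. left_coset \<Gamma> x \<in> S \<inter> T}"
      using S T by auto
  next
    fix \<K>
    assume K: "\<forall>S\<in>\<K>. S \<subseteq> range (left_coset \<Gamma>) \<and> open {x. left_coset \<Gamma> x \<in> S}"
    have "{x. left_coset \<Gamma> x \<in> \<Union>\<K>} = (\<Union>S\<in>\<K>. {x. left_coset \<Gamma> x \<in> S})"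
      by auto
    then show "\<Union>\<K> \<subseteq> range (left_coset \<Gamma>) \<and> open {x. left_coset \<Gamma> x \<in> \<Union>\<K>}"
      using K by auto
  qed
  then show ?thesis
    by (simp add: coset_topology_def topology_inverse')
qed

lemma topspace_coset_topology: "topspace (coset_topology \<Gamma>) = range (left_coset \<Gamma>)"
proof
  show "topspace (coset_topology \<Gamma>) \<subseteq> range (left_coset \<Gamma>)"
    unfolding topspace_def using openin_coset_topology by blast
  have "openin (coset_topology \<Gamma>) (range (left_coset \<Gamma>))"
    by (simp add: openin_coset_topology)
  then show "range (left_coset \<Gamma>) \<subseteq> topspace (coset_topology \<Gamma>)"
    by (rule openin_subset)
qed

lemma quotient_map_left_coset:
  "quotient_map euclidean (coset_topology \<Gamma>) (left_coset \<Gamma>)"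
  by (auto simp: quotient_map_def topspace_coset_topology openin_coset_topology)

definition invariant_radon_probability ::
    "'g::{topological_group_add,t2_space} set \<Rightarrow> 'g set measure \<Rightarrow> bool" where
  "invariant_radon_probability \<Gamma> \<nu> \<longleftrightarrow>
     radon_measure (coset_topology \<Gamma>) \<nu> \<and> emeasure \<nu> (space \<nu>) = 1 \<and>
     (\<forall>x. \<forall>B\<in>sets \<nu>. emeasure \<nu> ((`) ((+) x) ` B) = emeasure \<nu> B)"

definition is_lattice :: "'g::{topological_group_add,t2_space} set \<Rightarrow> bool" where
  "is_lattice \<Gamma> \<longleftrightarrow>
     add_subgroup \<Gamma> \<and> discrete \<Gamma> \<and> (\<exists>\<nu>. invariant_radon_probability \<Gamma> \<nu>)"

definition uniform_lattice :: "'g::{topological_group_add,t2_space} set \<Rightarrow> bool" where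
  "uniform_lattice \<Gamma> \<longleftrightarrow> is_lattice \<Gamma> \<and> compact_space (coset_topology \<Gamma>)"

section \<open>The map from means on the lattice to means on the group\<close>

text \<open>The value at a coset is computed at a chosen representative; for a left-invariant mean \<open>m\<close> and a
  subgroup \<open>\<Gamma>\<close> the choice does not matter.\<close>

definition coset_mean ::
    "'g::group_add set \<Rightarrow> (('g \<Rightarrow> complex) \<Rightarrow> complex) \<Rightarrow> ('g \<Rightarrow> complex) \<Rightarrow> 'g set \<Rightarrow> complex" where
  "coset_mean \<Gamma> m f C = (let x = (SOME x. left_coset \<Gamma> x = C) in m (\<lambda>\<gamma>\<in>\<Gamma>. f (x + \<gamma>)))"

definition iota ::
    "'g::{topological_group_add,t2_space} set \<Rightarrow> 'g set measure \<Rightarrow>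
     (('g \<Rightarrow> complex) \<Rightarrow> complex) \<Rightarrow> (('g \<Rightarrow> complex) \<Rightarrow> complex)" where
  "iota \<Gamma> \<nu> m = (\<lambda>f\<in>LUC. LINT C|\<nu>. coset_mean \<Gamma> m f C)"

end

theory Submission
  imports Defs
begin

text \<open>
  Let \<open>\<mu>\<close> be a left-invariant mean on \<open>LUC\<close>. A continuous kernel \<open>k\<close> of compact support and a bounded
  function \<open>\<phi>\<close> on \<open>\<Gamma>\<close> give the function \<open>spread k \<phi>\<close>, in which a copy of \<open>k\<close>, right-translated to
  \<open>\<gamma>\<close> and weighted by \<open>\<phi> \<gamma>\<close>, is attached to every lattice point \<open>\<gamma>\<close>. It lies in \<open>LUC\<close>
  (\<open>spread_LUC\<close>), and since only right translations were used to build it, a left translate of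
  \<open>spread k \<phi>\<close> is the function spread from a left translate of \<open>k\<close>. So for fixed \<open>\<phi>\<close> the map
  \<open>k \<mapsto> \<mu> (spread k \<phi>)\<close> is a left-invariant functional on functions of compact support, bounded
  on those with support in a given compact set. Uniqueness of the Haar integral (\<open>haar_unique\<close>) yields
  \<open>\<mu> (spread k \<phi>) = m \<phi> * haar k\<close> for a number \<open>m \<phi>\<close>, and this \<open>m\<close> is the mean that \<open>\<iota>\<close> maps
  to \<open>\<mu>\<close>.

  Here \<open>haar\<close> is the lift of \<open>\<nu>\<close>: the integral over the coset space of the sum of \<open>k\<close> over a coset.
  It is invariant under left translations by the group, because \<open>\<nu>\<close> is, and under right
  translations by \<open>\<Gamma>\<close>, by construction. The second invariance makes \<open>m\<close> left invariant: to translate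
  \<open>\<phi>\<close> by \<open>\<delta> \<in> \<Gamma>\<close> is to translate the kernel by \<open>\<delta>\<close> on the right (\<open>spread_shift\<close>).

  For \<open>\<iota> m = \<mu>\<close> let \<open>f\<close> be in \<open>LUC\<close> and let \<open>U\<close> be a neighbourhood of \<open>0\<close> such that
  \<open>f (u + x)\<close> and \<open>f x\<close> differ by at most \<open>\<epsilon>\<close> for \<open>u \<in> U\<close>. As the coset space is compact, there are
  finitely many kernels \<open>b a \<ge> 0\<close>, the one at \<open>a\<close> supported in \<open>U + a\<close>, whose sums over cosets add up
  to \<open>1\<close> (\<open>partition_exists\<close>). Then \<open>f\<close> is within \<open>\<epsilon>\<close> of the sum of the \<open>spread (b a) (\<lambda>\<gamma>. f (a + \<gamma>))\<close>
  (\<open>partition_approx\<close>), so \<open>\<mu> f\<close> is close to the sum of the \<open>m (\<lambda>\<gamma>. f (a + \<gamma>)) * haar (b a)\<close>. This is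
  also a Riemann sum for the integral that defines \<open>\<iota> m f\<close> (\<open>quadrature\<close>), and \<open>\<epsilon>\<close> was arbitrary.

  That \<open>\<iota>\<close> takes values in the left-invariant means (\<open>iota_in_LIM\<close>) only reflects the invariance of
  \<open>\<nu>\<close>. A topological left-invariant mean restricts to a left-invariant mean on \<open>LUC\<close>
  (\<open>TLIM_restrict\<close>): for \<open>\<phi>\<close> in \<open>LUC\<close> and a probability density \<open>g\<close> concentrated near \<open>0\<close>, the convolution
  \<open>g * \<phi>\<close> is uniformly close to \<open>\<phi>\<close>, and its left translates are convolutions of \<open>\<phi>\<close> with translates
  of \<open>g\<close>, so that the mean has the same value on all of them.
\<close>

section \<open>Continuous functions of compact support\<close>

text \<open>The set that carries the support is a parameter, and its compactness is a separate hypothesis, so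
  that finitely many functions can be put into one common linear space.\<close>

definition CC :: "'a::topological_space set \<Rightarrow> ('a \<Rightarrow> complex) set" where
  "CC K = {k. continuous_on UNIV k \<and> (\<forall>x. x \<notin> K \<longrightarrow> k x = 0)}"

lemma CC_cont: "k \<in> CC K \<Longrightarrow> continuous_on UNIV k"
  by (simp add: CC_def)

lemma CC_zero: "k \<in> CC K \<Longrightarrow> x \<notin> K \<Longrightarrow> k x = 0"
  by (simp add: CC_def)

lemma CC_mono: "k \<in> CC K \<Longrightarrow> K \<subseteq> L \<Longrightarrow> k \<in> CC L"
  by (auto simp: CC_def)

lemma CC_bounded:
  assumes "k \<in> CC K" "compact K"
  obtains c where "c > 0" "\<And>x. norm (k x) \<le> c"
proof -
  have "compact (k ` K)"
    using assms continuous_on_subset[OF CC_cont] by (blast intro: compact_continuous_image)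
  then obtain c where c: "c > 0" "\<And>y. y \<in> k ` K \<Longrightarrow> norm y \<le> c"
    using compact_imp_bounded bounded_pos by metis
  have "norm (k x) \<le> c" for x
    using c CC_zero[OF assms(1), of x] by (cases "x \<in> K") auto
  then show thesis using c(1) that by blast
qed

text \<open>Uniform continuity along an action, from the tube lemma on the compact support. A point that the
  action moves from outside into the support is treated by applying the inverse to its image, so the
  support need not be enlarged. The action is a parameter because left and right translations are
  both needed, as well as translations of one factor of a product.\<close>

lemma CC_action_uniform:
  fixes \<alpha> :: "'g::topological_group_add \<Rightarrow> 'p::topological_space \<Rightarrow> 'p"
  assumes \<alpha>: "continuous_on UNIV (\<lambda>(u, p). \<alpha> u p)" "\<And>p. \<alpha> 0 p = p"
      "\<And>u p. \<alpha> (- u) (\<alpha> u p) = p"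
    and F: "F \<in> CC K" and K: "compact K" and e: "e > 0"
  obtains U where "open U" "0 \<in> U" "\<And>u p. u \<in> U \<Longrightarrow> norm (F (\<alpha> u p) - F p) \<le> e"
proof -
  have "continuous_on (UNIV \<times> K) (F \<circ> (\<lambda>(u, p). \<alpha> u p))"
    by (intro continuous_on_compose continuous_on_subset[OF \<alpha>(1)]
        continuous_on_subset[OF CC_cont[OF F]]) auto
  then have c: "continuous_on (UNIV \<times> K) (\<lambda>(u, p). F (\<alpha> u p))"
    by (simp add: o_def case_prod_beta')
  obtain X where X: "0 \<in> X" "open X" and X_le:
    "\<forall>u\<in>X \<inter> UNIV. \<forall>p\<in>K. dist ((\<lambda>(u, p). F (\<alpha> u p)) (u, p)) ((\<lambda>(u, p). F (\<alpha> u p)) (0, p)) \<le> e"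
    by (rule continuous_on_prod_compactE[OF c K UNIV_I e, of 0])
  have X_le: "dist (F (\<alpha> u p)) (F (\<alpha> 0 p)) \<le> e" if "u \<in> X" "p \<in> K" for u p
    using X_le that by auto
  let ?U = "X \<inter> (\<lambda>u. - u) -` X"
  have o: "open ?U"
    by (intro open_Int X(2) open_vimage continuous_on_minus[OF continuous_on_id])
  have "norm (F (\<alpha> u p) - F p) \<le> e" if u: "u \<in> ?U" for u p
  proof (cases "p \<in> K")
    case True
    then show ?thesis using X_le[of u p] u by (simp add: dist_norm \<alpha>(2))
  next
    case False
    show ?thesis
    proof (cases "\<alpha> u p \<in> K")
      case True
      then have "dist (F (\<alpha> (-u) (\<alpha> u p))) (F (\<alpha> 0 (\<alpha> u p))) \<le> e"
        using X_le[of "- u" "\<alpha> u p"] u by simp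
      then show ?thesis by (simp add: \<alpha> dist_norm norm_minus_commute)
    next
      case False
      then show ?thesis using \<open>p \<notin> K\<close> e by (simp add: CC_zero[OF F])
    qed
  qed
  with o X(1) show thesis by (intro that[of ?U]) auto
qed

lemma CC_left_uniform:
  fixes k :: "'g::topological_group_add \<Rightarrow> complex"
  assumes "k \<in> CC K" "compact K" "e > 0"
  obtains U where "open U" "0 \<in> U" "\<And>u x. u \<in> U \<Longrightarrow> norm (k (u + x) - k x) \<le> e"
proof (rule CC_action_uniform[OF _ _ _ assms, of "(+)"])
  show "continuous_on UNIV (\<lambda>(u, p). u + p :: 'g)"
    unfolding case_prod_beta' by (intro continuous_intros)
qed (use that in auto)

lemma CC_right_uniform:
  fixes k :: "'g::topological_group_add \<Rightarrow> complex"
  assumes "k \<in> CC K" "compact K" "e > 0"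
  obtains U where "open U" "0 \<in> U" "\<And>u x. u \<in> U \<Longrightarrow> norm (k (x + u) - k x) \<le> e"
proof (rule CC_action_uniform[OF _ _ _ assms, of "\<lambda>u x. x + u"])
  show "continuous_on UNIV (\<lambda>(u, p). p + u :: 'g)"
    unfolding case_prod_beta' by (intro continuous_intros)
qed (use that in \<open>auto simp: add.assoc\<close>)

text \<open>Left and right uniform structures agree over a compact set of base points.\<close>

lemma conjugates_small:
  fixes K :: "'g::topological_group_add set"
  assumes "compact K" "open V" "0 \<in> V"
  obtains U where "open U" "0 \<in> U" "\<And>u y. u \<in> U \<Longrightarrow> y \<in> K \<Longrightarrow> - y + u + y \<in> V"
proof -
  let ?W = "(\<lambda>(u, y). - y + u + y) -` V"
  have "open ?W"
    unfolding case_prod_beta' by (intro open_vimage assms(2) continuous_intros)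
  moreover have "{0} \<times> K \<subseteq> ?W" using assms(3) by auto
  ultimately have "\<exists>X. 0 \<in> X \<and> open X \<and> X \<times> K \<subseteq> ?W"
    by (rule Elementary_Topology.tube_lemma[OF assms(1)])
  then obtain X where "0 \<in> X" "open X" "X \<times> K \<subseteq> ?W" by blast
  then show thesis by (intro that[of X]) auto
qed

lemma CC_add: "k \<in> CC K \<Longrightarrow> l \<in> CC K \<Longrightarrow> (\<lambda>x. k x + l x) \<in> CC K"
  by (auto simp: CC_def intro: continuous_on_add)

lemma CC_scale: "k \<in> CC K \<Longrightarrow> (\<lambda>x. c * k x) \<in> CC K"
  by (auto simp: CC_def intro: continuous_on_mult_left)

lemma CC_mult: "continuous_on UNIV f \<Longrightarrow> k \<in> CC K \<Longrightarrow> (\<lambda>x. f x * k x) \<in> CC K"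
  by (auto simp: CC_def intro: continuous_on_mult)

lemma continuous_on_translate:
  fixes f :: "'g::topological_group_add \<Rightarrow> 'b::topological_space"
  assumes "continuous_on UNIV f"
  shows "continuous_on UNIV (\<lambda>x. f (a + x))"
  by (rule continuous_on_compose2[OF assms])
    (auto intro: continuous_on_add continuous_on_const continuous_on_id)

text \<open>A locally compact Hausdorff space is completely regular; multiplying a separating function by its
  reflection makes it symmetric.\<close>

lemma symmetric_bump:
  fixes U :: "'g::{topological_group_add,t2_space} set"
  assumes lc: "locally_compact_space (euclidean :: 'g topology)" and U: "open U" "0 \<in> U"
  obtains h :: "'g \<Rightarrow> real" and K where "compact K" "continuous_on UNIV h"
    "\<And>x. 0 \<le> h x" "h 0 = 1" "\<And>x. h (- x) = h x" "\<And>x. x \<notin> K \<Longrightarrow> h x = 0" "\<And>x. x \<notin> U \<Longrightarrow> h x = 0"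
proof -
  have "Hausdorff_space (euclidean :: 'g topology)"
    unfolding Hausdorff_space_def disjnt_def using hausdorff by fastforce
  then have cr: "completely_regular_space (euclidean :: 'g topology)"
    using lc locally_compact_regular_imp_completely_regular_space by blast
  obtain W K :: "'g set" where W: "open W" "0 \<in> W" "W \<subseteq> K" and K: "compact K"
    using lc[unfolded locally_compact_space_def, rule_format, of 0] by auto
  have "closedin euclidean (- (U \<inter> W))" "0 \<in> topspace euclidean - (- (U \<inter> W))"
    using U W by auto
  then obtain f :: "'g \<Rightarrow> real" where f: "continuous_map euclidean (top_of_set {0..1}) f" "f 0 = 0"
     "f ` (- (U \<inter> W)) \<subseteq> {1}"
    using cr unfolding completely_regular_space_def by meson
  have cf: "continuous_on UNIV f" and r: "\<And>x. f x \<in> {0..1}"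
    using f(1) by (auto simp: continuous_map_in_subtopology)
  define h where "h x = (1 - f x) * (1 - f (- x))" for x
  show thesis
  proof (rule that[of K h])
    show "compact K" by (rule K)
    show "continuous_on UNIV h"
      unfolding h_def
      by (intro continuous_intros cf continuous_on_compose2[OF cf continuous_on_minus[OF continuous_on_id]]) auto
    show "0 \<le> h x" for x using r[of x] r[of "-x"] by (simp add: h_def)
    show "h 0 = 1" by (simp add: h_def f(2))
    show "h (- x) = h x" for x by (simp add: h_def)
    show "h x = 0" if "x \<notin> K" for x
    proof -
      have "f x = 1" using that W(3) f(3) by (auto simp: image_subset_iff)
      then show ?thesis by (simp add: h_def)
    qed
    show "h x = 0" if "x \<notin> U" for x
    proof -
      have "f x = 1" using that f(3) by (auto simp: image_subset_iff)
      then show ?thesis by (simp add: h_def)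
    qed
  qed
qed

lemma compact_translate:
  fixes K :: "'g::topological_group_add set"
  assumes "compact K"
  shows "compact ((\<lambda>x. a + x) ` K)" "compact ((\<lambda>x. x + a) ` K)"
  by (intro compact_continuous_image assms continuous_on_add continuous_on_const continuous_on_id)+

lemma CC_left_translate:
  fixes k :: "'g::topological_group_add \<Rightarrow> complex"
  assumes "k \<in> CC K"
  shows "(\<lambda>x. k (a + x)) \<in> CC ((\<lambda>x. - a + x) ` K)"
  unfolding CC_def
proof (intro CollectI conjI allI impI)
  show "continuous_on UNIV (\<lambda>x. k (a + x))"
    by (rule continuous_on_compose2[OF CC_cont[OF assms]])
      (auto intro: continuous_on_add continuous_on_const continuous_on_id)
  show "k (a + x) = 0" if "x \<notin> (\<lambda>x. - a + x) ` K" for x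
    using that by (intro CC_zero[OF assms]) (metis image_eqI minus_add_cancel)
qed

lemma CC_right_translate:
  fixes k :: "'g::topological_group_add \<Rightarrow> complex"
  assumes "k \<in> CC K"
  shows "(\<lambda>x. k (x + a)) \<in> CC ((\<lambda>x. x + - a) ` K)"
  unfolding CC_def
proof (intro CollectI conjI allI impI)
  show "continuous_on UNIV (\<lambda>x. k (x + a))"
    by (rule continuous_on_compose2[OF CC_cont[OF assms]])
      (auto intro: continuous_on_add continuous_on_const continuous_on_id)
  show "k (x + a) = 0" if "x \<notin> (\<lambda>x. x + - a) ` K" for x
  proof (rule CC_zero[OF assms])
    have "x = (x + a) + - a" by (simp add: add.assoc)
    then show "x + a \<notin> K" using that by blast
  qed
qed

section \<open>Left uniformly continuous functions\<close>

lemma left_uniform_imp_continuous: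
  fixes f :: "'g::topological_group_add \<Rightarrow> complex"
  assumes "\<And>e. e > 0 \<Longrightarrow> \<exists>U. open U \<and> 0 \<in> U \<and> (\<forall>u\<in>U. \<forall>x. norm (f (u + x) - f x) \<le> e)"
  shows "continuous_on UNIV f"
  unfolding continuous_on_def
proof (intro ballI tendstoI)
  fix x :: 'g and e :: real
  assume "e > 0"
  then obtain U where U: "open U" "0 \<in> U" "\<And>u x. u \<in> U \<Longrightarrow> norm (f (u + x) - f x) \<le> e / 2"
    using assms[of "e / 2"] by auto
  have "open ((\<lambda>y. y - x) -` U)"
    by (intro open_vimage U(1) continuous_intros)
  moreover have "x \<in> (\<lambda>y. y - x) -` U" using U(2) by simp
  moreover have "dist (f y) (f x) < e" if "y \<in> (\<lambda>y. y - x) -` U" for y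
    using U(3)[of "y - x" x] that \<open>e > 0\<close> by (simp add: dist_norm)
  ultimately show "\<forall>\<^sub>F y in at x within UNIV. dist (f y) (f x) < e"
    unfolding eventually_at_topological by blast
qed

text \<open>Boundedness makes the supremum in the definition meaningful, so it can be traded for a uniform
  estimate, which already entails continuity.\<close>

lemma LUC_iff:
  "f \<in> LUC \<longleftrightarrow> bounded (range f) \<and>
    (\<forall>e>0. \<exists>U. open U \<and> 0 \<in> U \<and> (\<forall>u\<in>U. \<forall>x. norm (f (u + x) - f x) \<le> e))"
  (is "_ \<longleftrightarrow> ?B \<and> ?U")
proof
  assume f: "f \<in> LUC"
  then have b: ?B and l: "((\<lambda>x. SUP y. norm (f y - f (x + y))) \<longlongrightarrow> 0) (at 0)"
    by (auto simp: LUC_def)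
  obtain c where c: "\<And>x. norm (f x) \<le> c" using b by (auto simp: bounded_iff)
  have bdd: "bdd_above (range (\<lambda>y. norm (f y - f (x + y))))" for x
  proof (rule bdd_aboveI)
    fix z assume "z \<in> range (\<lambda>y. norm (f y - f (x + y)))"
    then obtain y where "z = norm (f y - f (x + y))" by auto
    then show "z \<le> c + c"
      using c[of y] c[of "x + y"] norm_triangle_ineq4[of "f y" "f (x+y)"] by linarith
  qed
  have ?U
  proof (intro allI impI)
    fix e :: real assume "e > 0"
    then have "\<forall>\<^sub>F x in at 0. dist (SUP y. norm (f y - f (x + y))) 0 < e"
      by (rule tendstoD[OF l])
    then obtain U where U: "open U" "0 \<in> U"
      "\<And>x. x \<in> U \<Longrightarrow> x \<noteq> 0 \<Longrightarrow> dist (SUP y. norm (f y - f (x + y))) 0 < e"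
      unfolding eventually_at_topological by blast
    have "norm (f (u + x) - f x) \<le> e" if "u \<in> U" for u x
    proof (cases "u = 0")
      case True then show ?thesis using \<open>e > 0\<close> by simp
    next
      case False
      have "norm (f x - f (u + x)) \<le> (SUP y. norm (f y - f (u + y)))"
        by (rule cSUP_upper[OF _ bdd]) simp
      then show ?thesis using U(3)[OF that False] by (simp add: norm_minus_commute)
    qed
    then show "\<exists>U. open U \<and> 0 \<in> U \<and> (\<forall>u\<in>U. \<forall>x. norm (f (u + x) - f x) \<le> e)"
      using U(1,2) by blast
  qed
  with b show "?B \<and> ?U" by blast
next
  assume a: "?B \<and> ?U"
  have "((\<lambda>x. SUP y. norm (f y - f (x + y))) \<longlongrightarrow> 0) (at 0)"
  proof (rule tendstoI)
    fix e :: real assume "e > 0"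
    then have "e / 2 > 0" by simp
    then obtain U where U: "open U" "0 \<in> U" "\<And>u x. u \<in> U \<Longrightarrow> norm (f (u + x) - f x) \<le> e / 2"
      using a[THEN conjunct2, rule_format, of "e / 2"] by auto
    have "dist (SUP y. norm (f y - f (u + y))) 0 < e" if "u \<in> U" for u
    proof -
      have le: "norm (f y - f (u + y)) \<le> e / 2" for y
        using U(3)[OF that, of y] by (simp add: norm_minus_commute)
      then have "(SUP y. norm (f y - f (u + y))) \<le> e / 2"
        by (intro cSUP_least) auto
      moreover have "bdd_above (range (\<lambda>y. norm (f y - f (u + y))))"
        by (rule bdd_aboveI[where M = "e / 2"]) (use le in auto)
      then have "norm (f 0 - f (u + 0)) \<le> (SUP y. norm (f y - f (u + y)))"
        by (rule cSUP_upper[OF UNIV_I])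
      then have "0 \<le> (SUP y. norm (f y - f (u + y)))"
        by (rule order_trans[OF norm_ge_zero])
      ultimately show ?thesis using \<open>e > 0\<close> by (simp add: dist_real_def)
    qed
    then show "\<forall>\<^sub>F u in at 0. dist (SUP y. norm (f y - f (u + y))) 0 < e"
      using U(1,2) unfolding eventually_at_topological by blast
  qed
  then show "f \<in> LUC"
    using a left_uniform_imp_continuous[of f] by (auto simp: LUC_def)
qed

lemma LUC_bound:
  assumes "f \<in> LUC"
  obtains c where "c > 0" "\<And>x. norm (f x) \<le> c"
proof -
  have "bounded (range f)" using assms by (simp add: LUC_def)
  then obtain c where "c > 0" "\<And>y. y \<in> range f \<Longrightarrow> norm y \<le> c" using bounded_pos by metis
  then show thesis using that by blast
qed

lemma LUC_cont: "f \<in> LUC \<Longrightarrow> continuous_on UNIV f"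
  by (simp add: LUC_def)

lemma LUC_uniform:
  assumes "f \<in> LUC" "e > 0"
  obtains U where "open U" "0 \<in> U" "\<And>u x. u \<in> U \<Longrightarrow> norm (f (u + x) - f x) \<le> e"
  using assms(1)[unfolded LUC_iff] assms(2) by meson

lemma LUC_I:
  assumes "\<And>x. norm (f x) \<le> c"
    and "\<And>e. e > 0 \<Longrightarrow> \<exists>U. open U \<and> 0 \<in> U \<and> (\<forall>u\<in>U. \<forall>x. norm (f (u + x) - f x) \<le> e)"
  shows "f \<in> LUC"
  using assms unfolding LUC_iff bounded_iff by blast

lemma LUC_const: "(\<lambda>x. c) \<in> LUC"
  by (rule LUC_I[of _ "norm c"]) (auto intro: exI[of _ UNIV])

lemma LUC_add:
  assumes "f \<in> LUC" "g \<in> LUC"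
  shows "(\<lambda>x. f x + g x) \<in> LUC"
proof -
  obtain c where c: "\<And>x. norm (f x) \<le> c" by (rule LUC_bound[OF assms(1)]) blast
  obtain d where d: "\<And>x. norm (g x) \<le> d" by (rule LUC_bound[OF assms(2)]) blast
  show ?thesis
  proof (rule LUC_I)
    show "norm (f x + g x) \<le> c + d" for x
      using c[of x] d[of x] norm_triangle_ineq[of "f x" "g x"] by linarith
  next
    fix e :: real assume "e > 0"
    then have e2: "e / 2 > 0" by simp
    obtain U where U: "open U" "0 \<in> U" "\<And>u x. u \<in> U \<Longrightarrow> norm (f (u + x) - f x) \<le> e / 2"
      using LUC_uniform[OF assms(1) e2] by blast
    obtain V where V: "open V" "0 \<in> V" "\<And>u x. u \<in> V \<Longrightarrow> norm (g (u + x) - g x) \<le> e / 2"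
      using LUC_uniform[OF assms(2) e2] by blast
    have "norm (f (u + x) + g (u + x) - (f x + g x)) \<le> e" if "u \<in> U \<inter> V" for u x
    proof -
      have "norm (f (u + x) + g (u + x) - (f x + g x)) \<le> norm (f (u + x) - f x) + norm (g (u + x) - g x)"
        by (rule norm_diff_triangle_ineq)
      then show ?thesis using U(3)[of u x] V(3)[of u x] that by auto
    qed
    then show "\<exists>U. open U \<and> 0 \<in> U \<and> (\<forall>u\<in>U. \<forall>x. norm (f (u + x) + g (u + x) - (f x + g x)) \<le> e)"
      using U(1,2) V(1,2) by (intro exI[of _ "U \<inter> V"]) auto
  qed
qed

lemma LUC_contraction:
  assumes "f \<in> LUC" and T: "\<And>z w. norm (T z - T w) \<le> L * norm (z - w)"
  shows "(\<lambda>x. T (f x)) \<in> LUC"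
proof -
  obtain c where c: "\<And>x. norm (f x) \<le> c" by (rule LUC_bound[OF assms(1)]) blast
  have L: "norm (T z - T w) \<le> (\<bar>L\<bar> + 1) * norm (z - w)" for z w
    by (rule order_trans[OF T]) (simp add: mult_right_mono)
  show ?thesis
  proof (rule LUC_I)
    show "norm (T (f x)) \<le> norm (T 0) + (\<bar>L\<bar> + 1) * c" for x
    proof -
      have "norm (T (f x)) \<le> norm (T 0) + norm (T (f x) - T 0)"
        by (metis add.commute diff_add_cancel norm_triangle_ineq)
      moreover have "norm (T (f x) - T 0) \<le> (\<bar>L\<bar> + 1) * norm (f x)" using L[of "f x" 0] by simp
      moreover have "(\<bar>L\<bar> + 1) * norm (f x) \<le> (\<bar>L\<bar> + 1) * c"
        using c[of x] by (intro mult_left_mono) auto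
      ultimately show ?thesis by linarith
    qed
  next
    fix e :: real assume "e > 0"
    then have e2: "e / (\<bar>L\<bar> + 1) > 0" by (simp add: add_nonneg_pos)
    obtain U where U: "open U" "0 \<in> U" "\<And>u x. u \<in> U \<Longrightarrow> norm (f (u + x) - f x) \<le> e / (\<bar>L\<bar> + 1)"
      using LUC_uniform[OF assms(1) e2] by blast
    have "norm (T (f (u + x)) - T (f x)) \<le> e" if "u \<in> U" for u x
    proof -
      have "norm (T (f (u + x)) - T (f x)) \<le> (\<bar>L\<bar> + 1) * norm (f (u + x) - f x)" by (rule L)
      also have "\<dots> \<le> (\<bar>L\<bar> + 1) * (e / (\<bar>L\<bar> + 1))"
        using U(3)[OF that] by (intro mult_left_mono) auto
      also have "\<dots> = e" by (simp add: add_nonneg_pos less_imp_neq[symmetric])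
      finally show ?thesis .
    qed
    then show "\<exists>U. open U \<and> 0 \<in> U \<and> (\<forall>u\<in>U. \<forall>x. norm (T (f (u + x)) - T (f x)) \<le> e)"
      using U(1,2) by blast
  qed
qed

lemma LUC_scale: "f \<in> LUC \<Longrightarrow> (\<lambda>x. c * f x) \<in> LUC"
  by (rule LUC_contraction[where L = "norm c"]) (auto simp flip: right_diff_distrib simp: norm_mult)

lemma LUC_cnj: "f \<in> LUC \<Longrightarrow> (\<lambda>x. cnj (f x)) \<in> LUC"
  by (rule LUC_contraction[where L = 1]) (auto simp flip: complex_cnj_diff)

lemma LUC_translate:
  assumes "f \<in> LUC"
  shows "(\<lambda>x. f (a + x)) \<in> LUC"
proof -
  obtain c where c: "\<And>x. norm (f x) \<le> c" by (rule LUC_bound[OF assms(1)]) blast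
  show ?thesis
  proof (rule LUC_I[OF c])
    fix e :: real assume e: "e > 0"
    obtain U where U: "open U" "0 \<in> U" "\<And>u x. u \<in> U \<Longrightarrow> norm (f (u + x) - f x) \<le> e"
      using LUC_uniform[OF assms e] by blast
    obtain V where V: "open V" "0 \<in> V" "\<And>u y. u \<in> V \<Longrightarrow> y \<in> {-a} \<Longrightarrow> - y + u + y \<in> U"
      by (rule conjugates_small[OF _ U(1,2), of "{-a}"]) (simp, blast)
    have "norm (f (a + (u + x)) - f (a + x)) \<le> e" if "u \<in> V" for u x
      using U(3)[OF V(3)[OF that, of "-a"], of "a + x"]
      by (simp add: add.assoc diff_conv_add_uminus del: add_uminus_conv_diff)
    then show "\<exists>U. open U \<and> 0 \<in> U \<and> (\<forall>u\<in>U. \<forall>x. norm (f (a + (u + x)) - f (a + x)) \<le> e)"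
      using V(1,2) by blast
  qed
qed

section \<open>Means on spaces of bounded functions\<close>

text \<open>The closure properties that bounds for a mean need: real and imaginary parts are available
  through complex conjugation.\<close>

definition mean_domain :: "'a set \<Rightarrow> ('a \<Rightarrow> complex) set \<Rightarrow> bool" where
  "mean_domain X V \<longleftrightarrow> V \<subseteq> extensional X \<and> (\<lambda>x\<in>X. 1) \<in> V \<and>
     (\<forall>f\<in>V. \<forall>g\<in>V. (\<lambda>x\<in>X. f x + g x) \<in> V) \<and> (\<forall>c. \<forall>f\<in>V. (\<lambda>x\<in>X. c * f x) \<in> V) \<and>
     (\<forall>f\<in>V. (\<lambda>x\<in>X. cnj (f x)) \<in> V)"

lemma mean_domain_add: "mean_domain X V \<Longrightarrow> f \<in> V \<Longrightarrow> g \<in> V \<Longrightarrow> (\<lambda>x\<in>X. f x + g x) \<in> V"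
  and mean_domain_scale: "mean_domain X V \<Longrightarrow> f \<in> V \<Longrightarrow> (\<lambda>x\<in>X. c * f x) \<in> V"
  and mean_domain_cnj: "mean_domain X V \<Longrightarrow> f \<in> V \<Longrightarrow> (\<lambda>x\<in>X. cnj (f x)) \<in> V"
  and mean_domain_one: "mean_domain X V \<Longrightarrow> (\<lambda>x\<in>X. 1) \<in> V"
  unfolding mean_domain_def by auto

lemma mean_domain_LUC: "mean_domain UNIV LUC"
  by (simp add: mean_domain_def restrict_UNIV LUC_const LUC_add LUC_scale LUC_cnj)

lemma linf_I: "(\<And>x. x \<in> X \<Longrightarrow> norm (f x) \<le> c) \<Longrightarrow> (\<lambda>x\<in>X. f x) \<in> linf X"
  unfolding linf_def bounded_iff by auto

lemma linf_bound:
  assumes "f \<in> linf X"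
  obtains c where "c > 0" "\<And>x. x \<in> X \<Longrightarrow> norm (f x) \<le> c"
proof -
  have "bounded (f ` X)" using assms by (simp add: linf_def)
  then obtain c where "c > 0" "\<And>y. y \<in> f ` X \<Longrightarrow> norm y \<le> c" using bounded_pos by metis
  then show thesis using that by blast
qed

lemma mean_domain_linf: "mean_domain X (linf X)"
  unfolding mean_domain_def
proof (intro conjI ballI allI)
  show "linf X \<subseteq> extensional X" by (auto simp: linf_def)
  show "(\<lambda>x\<in>X. 1) \<in> linf X" by (rule linf_I[of _ _ 1]) simp
next
  fix f g :: "'a \<Rightarrow> complex" assume fg: "f \<in> linf X" "g \<in> linf X"
  obtain c where "\<And>x. x \<in> X \<Longrightarrow> norm (f x) \<le> c" by (rule linf_bound[OF fg(1)]) blast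
  moreover obtain d where "\<And>x. x \<in> X \<Longrightarrow> norm (g x) \<le> d" by (rule linf_bound[OF fg(2)]) blast
  ultimately show "(\<lambda>x\<in>X. f x + g x) \<in> linf X"
    by (intro linf_I[of _ _ "c + d"] norm_triangle_mono) auto
next
  fix f :: "'a \<Rightarrow> complex" and k assume f: "f \<in> linf X"
  obtain c where c: "\<And>x. x \<in> X \<Longrightarrow> norm (f x) \<le> c" by (rule linf_bound[OF f]) blast
  show "(\<lambda>x\<in>X. k * f x) \<in> linf X"
    by (rule linf_I[of _ _ "norm k * c"]) (simp add: norm_mult mult_left_mono c)
  show "(\<lambda>x\<in>X. cnj (f x)) \<in> linf X"
    by (rule linf_I[of _ _ c]) (simp add: c)
qed

context
  fixes X :: "'a set" and V m
  assumes dom: "mean_domain X V" and mean: "is_mean X V m"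
begin

lemma mean_add: "f \<in> V \<Longrightarrow> g \<in> V \<Longrightarrow> m (\<lambda>x\<in>X. f x + g x) = m f + m g"
  and mean_scale: "f \<in> V \<Longrightarrow> m (\<lambda>x\<in>X. c * f x) = c * m f"
  and mean_pos: "f \<in> V \<Longrightarrow> (\<And>x. x \<in> X \<Longrightarrow> f x \<in> \<real>\<^sub>\<ge>\<^sub>0) \<Longrightarrow> m f \<in> \<real>\<^sub>\<ge>\<^sub>0"
  and mean_one: "m (\<lambda>x\<in>X. 1) = 1"
  using mean unfolding is_mean_def by auto

lemma mean_diff:
  assumes "f \<in> V" "g \<in> V"
  shows "(\<lambda>x\<in>X. f x - g x) \<in> V" "m (\<lambda>x\<in>X. f x - g x) = m f - m g"
proof -
  have eq: "(\<lambda>x\<in>X. f x - g x) = (\<lambda>x\<in>X. f x + (\<lambda>x\<in>X. -1 * g x) x)" by auto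
  show "(\<lambda>x\<in>X. f x - g x) \<in> V" 
    unfolding eq by (rule mean_domain_add[OF dom assms(1) mean_domain_scale[OF dom assms(2)]])
  show "m (\<lambda>x\<in>X. f x - g x) = m f - m g"
    unfolding eq using mean_add[OF assms(1) mean_domain_scale[OF dom assms(2), of "-1"]]
      mean_scale[OF assms(2), of "-1"] by simp
qed

lemma mean_const: "(\<lambda>x\<in>X. c) \<in> V" "m (\<lambda>x\<in>X. c) = c"
proof -
  have eq: "(\<lambda>x\<in>X. c) = (\<lambda>x\<in>X. c * (\<lambda>x\<in>X. 1) x)" by auto
  show "(\<lambda>x\<in>X. c) \<in> V" unfolding eq by (intro mean_domain_scale[OF dom] mean_domain_one[OF dom])
  show "m (\<lambda>x\<in>X. c) = c" unfolding eq using mean_scale[OF mean_domain_one[OF dom], of c] mean_one by simp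
qed

lemma mean_real_bound:
  assumes f: "f \<in> V" and b: "\<And>x. x \<in> X \<Longrightarrow> f x \<in> \<real> \<and> norm (f x) \<le> c"
  shows "norm (m f) \<le> c"
proof -
  have nn: "of_real c - z \<in> \<real>\<^sub>\<ge>\<^sub>0" "of_real c + z \<in> \<real>\<^sub>\<ge>\<^sub>0" if "z \<in> \<real>" "norm z \<le> c" for z :: complex
    using that by (auto simp: complex_nonneg_Reals_iff complex_is_Real_iff cmod_eq_Re)
  have "m (\<lambda>x\<in>X. (\<lambda>x\<in>X. of_real c) x - f x) \<in> \<real>\<^sub>\<ge>\<^sub>0"
    by (rule mean_pos[OF mean_diff(1)[OF mean_const(1) f]]) (simp add: nn b)
  moreover have "m (\<lambda>x\<in>X. (\<lambda>x\<in>X. of_real c) x + f x) \<in> \<real>\<^sub>\<ge>\<^sub>0"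
    by (rule mean_pos[OF mean_domain_add[OF dom mean_const(1) f]]) (simp add: nn b)
  ultimately have "of_real c - m f \<in> \<real>\<^sub>\<ge>\<^sub>0" "of_real c + m f \<in> \<real>\<^sub>\<ge>\<^sub>0"
    using mean_diff(2)[OF mean_const(1) f] mean_add[OF mean_const(1) f] mean_const(2) by auto
  then show ?thesis by (auto simp: complex_nonneg_Reals_iff cmod_eq_Re)
qed

text \<open>Real and imaginary part are bounded separately, whence the factor \<open>2\<close>; it disappears in limits.\<close>

lemma mean_bound:
  assumes f: "f \<in> V" and b: "\<And>x. x \<in> X \<Longrightarrow> norm (f x) \<le> c"
  shows "norm (m f) \<le> 2 * c"
proof -
  let ?r = "\<lambda>x\<in>X. (1/2) * (\<lambda>x\<in>X. f x + (\<lambda>x\<in>X. cnj (f x)) x) x"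
  let ?i = "\<lambda>x\<in>X. (-\<i>/2) * (\<lambda>x\<in>X. f x - (\<lambda>x\<in>X. cnj (f x)) x) x"
  have V: "?r \<in> V" "?i \<in> V"
    by (rule mean_domain_scale[OF dom mean_domain_add[OF dom f mean_domain_cnj[OF dom f]]])
       (rule mean_domain_scale[OF dom mean_diff(1)[OF f mean_domain_cnj[OF dom f]]])
  have r: "?r x = of_real (Re (f x))" "?i x = of_real (Im (f x))" if "x \<in> X" for x
    using that by (auto simp: complex_eq_iff)
  have "norm (m ?r) \<le> c" "norm (m ?i) \<le> c"
    by (rule mean_real_bound[OF V(1)], simp only: r,
        use b order_trans[OF abs_Re_le_cmod] in simp)
       (rule mean_real_bound[OF V(2)], simp only: r,
        use b order_trans[OF abs_Im_le_cmod] in simp)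
  moreover have "f = (\<lambda>x\<in>X. ?r x + (\<lambda>x\<in>X. \<i> * ?i x) x)"
  proof (rule extensionalityI[of _ X])
    show "f \<in> extensional X" using f dom by (auto simp: mean_domain_def)
    show "f x = (\<lambda>x\<in>X. ?r x + (\<lambda>x\<in>X. \<i> * ?i x) x) x" if "x \<in> X" for x
      using that by (simp add: complex_eq_iff)
  qed auto
  then have "m f = m ?r + \<i> * m ?i"
    using mean_add[OF V(1) mean_domain_scale[OF dom V(2), of \<i>]] mean_scale[OF V(2), of \<i>] by metis
  ultimately show ?thesis
    using norm_triangle_ineq[of "m ?r" "\<i> * m ?i"] by (simp add: norm_mult)
qed

lemma mean_close:
  assumes f: "f \<in> V" "g \<in> V" and b: "\<And>x. x \<in> X \<Longrightarrow> norm (f x - g x) \<le> c"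
  shows "norm (m f - m g) \<le> 2 * c"
  using mean_bound[OF mean_diff(1)[OF f], of c] mean_diff(2)[OF f] b by simp

lemma mean_sum:
  assumes "finite A" "\<And>a. a \<in> A \<Longrightarrow> f a \<in> V"
  shows "(\<lambda>x\<in>X. \<Sum>a\<in>A. f a x) \<in> V \<and> m (\<lambda>x\<in>X. \<Sum>a\<in>A. f a x) = (\<Sum>a\<in>A. m (f a))"
  using assms
proof (induction A rule: finite_induct)
  case empty
  then show ?case using mean_const[of 0] by (simp add: restrict_def)
next
  case (insert a A)
  have eq: "(\<lambda>x\<in>X. \<Sum>a\<in>insert a A. f a x) = (\<lambda>x\<in>X. f a x + (\<lambda>x\<in>X. \<Sum>a\<in>A. f a x) x)"
    using insert.hyps by auto
  have IH: "(\<lambda>x\<in>X. \<Sum>a\<in>A. f a x) \<in> V" "m (\<lambda>x\<in>X. \<Sum>a\<in>A. f a x) = (\<Sum>a\<in>A. m (f a))"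
    using insert.IH insert.prems by blast+
  have fa: "f a \<in> V" using insert.prems by blast
  show ?case unfolding eq mean_add[OF fa IH(1)] IH(2)
    using mean_domain_add[OF dom fa IH(1)] insert.hyps by (simp del: restrict_apply)
qed

end

lemma nonneg_Reals_sum_complex:
  fixes f :: "'b \<Rightarrow> complex"
  shows "(\<And>a. a \<in> A \<Longrightarrow> f a \<in> \<real>\<^sub>\<ge>\<^sub>0) \<Longrightarrow> (\<Sum>a\<in>A. f a) \<in> \<real>\<^sub>\<ge>\<^sub>0"
  by (simp add: complex_nonneg_Reals_iff sum_nonneg)

section \<open>Invariant functionals on functions of compact support\<close>

text \<open>Positivity is replaced by boundedness on functions with a common compact support, since the
  functionals of interest depend on a complex weight on the lattice.\<close>

definition invariant_functional :: "(('g::topological_group_add \<Rightarrow> complex) \<Rightarrow> complex) \<Rightarrow> bool" where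
  "invariant_functional I \<longleftrightarrow>
     (\<forall>K k l c. compact K \<longrightarrow> k \<in> CC K \<longrightarrow> l \<in> CC K \<longrightarrow> I (\<lambda>x. k x + c * l x) = I k + c * I l) \<and>
     (\<forall>K k a. compact K \<longrightarrow> k \<in> CC K \<longrightarrow> I (\<lambda>x. k (a + x)) = I k) \<and>
     (\<forall>K. compact K \<longrightarrow> (\<exists>C>0. \<forall>k\<in>CC K. \<forall>e. (\<forall>x. norm (k x) \<le> e) \<longrightarrow> norm (I k) \<le> C * e))"

lemma invariant_functional_sum:
  assumes I: "invariant_functional I" and K: "compact K" and "finite S" and "\<And>s. s \<in> S \<Longrightarrow> k s \<in> CC K"
  shows "(\<lambda>x. \<Sum>s\<in>S. c s * k s x) \<in> CC K \<and> I (\<lambda>x. \<Sum>s\<in>S. c s * k s x) = (\<Sum>s\<in>S. c s * I (k s))"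
  using assms(3,4)
proof (induction S rule: finite_induct)
  case empty
  have z: "(\<lambda>_. 0) \<in> CC K" by (simp add: CC_def)
  have "I (\<lambda>x. 0 + (-1) * 0) = I (\<lambda>_. 0) + (-1) * I (\<lambda>_. 0)"
    using I[unfolded invariant_functional_def, THEN conjunct1, rule_format, OF K z z, of "-1"] .
  then show ?case using z by simp
next
  case (insert s S)
  have s: "k s \<in> CC K" and IH: "(\<lambda>x. \<Sum>s\<in>S. c s * k s x) \<in> CC K"
      "I (\<lambda>x. \<Sum>s\<in>S. c s * k s x) = (\<Sum>s\<in>S. c s * I (k s))"
    using insert by blast+
  have "I (\<lambda>x. (\<Sum>s\<in>S. c s * k s x) + c s * k s x) = I (\<lambda>x. \<Sum>s\<in>S. c s * k s x) + c s * I (k s)"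
    using I[unfolded invariant_functional_def, THEN conjunct1, rule_format, OF K IH(1) s] .
  moreover have "(\<lambda>x. (\<Sum>s\<in>S. c s * k s x) + c s * k s x) \<in> CC K"
    by (intro CC_add IH CC_scale s)
  ultimately show ?case using insert.hyps IH(2) by (simp add: add.commute)
qed

section \<open>Spreading functions from the lattice to the group\<close>

locale lattice_setting =
  fixes \<Gamma> :: "'g::{topological_group_add,t2_space} set" and \<nu> :: "'g set measure"
  assumes lc: "locally_compact_space (euclidean :: 'g topology)"
    and uniform: "uniform_lattice \<Gamma>"
    and inv_prob: "invariant_radon_probability \<Gamma> \<nu>"
begin

lemma zero_in: "0 \<in> \<Gamma>" and add_in: "x \<in> \<Gamma> \<Longrightarrow> y \<in> \<Gamma> \<Longrightarrow> x + y \<in> \<Gamma>" and minus_in: "x \<in> \<Gamma> \<Longrightarrow> - x \<in> \<Gamma>"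
  using uniform by (auto simp: uniform_lattice_def is_lattice_def add_subgroup_def)

text \<open>If \<open>W\<close> is so small that differences of its elements meet \<open>\<Gamma>\<close> only in \<open>0\<close>, then a left translate of
  \<open>W\<close> contains at most one point of each left coset of \<open>\<Gamma>\<close>. The number of translates that cover
  \<open>K\<close> therefore bounds every fibre, uniformly in the coset.\<close>

lemma fibre_bound:
  assumes K: "compact K"
  obtains N where "\<And>x. finite {\<gamma>\<in>\<Gamma>. x + \<gamma> \<in> K} \<and> card {\<gamma>\<in>\<Gamma>. x + \<gamma> \<in> K} \<le> N"
proof -
  have "discrete \<Gamma>" using uniform by (auto simp: uniform_lattice_def is_lattice_def)
  then have "0 isolated_in \<Gamma>" using zero_in by (rule discreteD)
  then obtain V where V: "open V" "V \<inter> \<Gamma> = {0}"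
    unfolding isolated_in_def by blast
  let ?D = "(\<lambda>(a, b). - a + b) -` V"
  have "open ?D" unfolding case_prod_beta' by (intro open_vimage V(1) continuous_intros)
  moreover have "(0, 0) \<in> ?D" using V(2) by auto
  ultimately obtain A B where AB: "open A" "open B" "0 \<in> A" "0 \<in> B" "A \<times> B \<subseteq> ?D"
    by (rule open_prod_elim) blast
  define W where "W c = (\<lambda>x. - c + x) -` (A \<inter> B)" for c
  have W: "open (W c)" for c
    unfolding W_def by (intro open_vimage open_Int AB continuous_intros)
  have "K \<subseteq> (\<Union>c\<in>K. W c)" using AB by (auto simp: W_def)
  then obtain C where C: "C \<subseteq> K" "finite C" "K \<subseteq> (\<Union>c\<in>C. W c)"
    using compactE_image[OF K, of K W] W by blast
  have inj: "\<gamma> = \<gamma>'" if "\<gamma> \<in> \<Gamma>" "\<gamma>' \<in> \<Gamma>" "x + \<gamma> \<in> W c" "x + \<gamma>' \<in> W c" for x \<gamma> \<gamma>' c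
  proof -
    have "- (- c + (x + \<gamma>)) + (- c + (x + \<gamma>')) \<in> V"
    proof -
      have "(- c + (x + \<gamma>), - c + (x + \<gamma>')) \<in> ?D"
        using that(3,4) by (intro subsetD[OF AB(5)]) (simp add: W_def)
      then show ?thesis by simp
    qed
    moreover have "- (- c + (x + \<gamma>)) + (- c + (x + \<gamma>')) = - \<gamma> + \<gamma>'"
      by (simp add: minus_add add.assoc diff_conv_add_uminus del: add_uminus_conv_diff)
    ultimately have "- \<gamma> + \<gamma>' \<in> V \<inter> \<Gamma>" using that add_in minus_in by auto
    then have "- \<gamma> + \<gamma>' = 0" using V(2) by blast
    then show ?thesis by (metis add_minus_cancel add.right_neutral)
  qed
  have "finite {\<gamma>\<in>\<Gamma>. x + \<gamma> \<in> K} \<and> card {\<gamma>\<in>\<Gamma>. x + \<gamma> \<in> K} \<le> card C" for x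
  proof -
    have "\<exists>c\<in>C. x + \<gamma> \<in> W c" if "x + \<gamma> \<in> K" for \<gamma> using C(3) that by blast
    then obtain s where s: "\<And>\<gamma>. x + \<gamma> \<in> K \<Longrightarrow> s \<gamma> \<in> C \<and> x + \<gamma> \<in> W (s \<gamma>)" by metis
    have i: "inj_on s {\<gamma>\<in>\<Gamma>. x + \<gamma> \<in> K}"
    proof (rule inj_onI)
      fix \<gamma> \<gamma>' assume a: "\<gamma> \<in> {\<gamma>\<in>\<Gamma>. x + \<gamma> \<in> K}" "\<gamma>' \<in> {\<gamma>\<in>\<Gamma>. x + \<gamma> \<in> K}" "s \<gamma> = s \<gamma>'"
      then have "x + \<gamma> \<in> W (s \<gamma>)" "x + \<gamma>' \<in> W (s \<gamma>)" using s[of \<gamma>] s[of \<gamma>'] by auto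
      then show "\<gamma> = \<gamma>'" using inj a(1,2) by blast
    qed
    have sub: "s ` {\<gamma>\<in>\<Gamma>. x + \<gamma> \<in> K} \<subseteq> C" using s by auto
    show ?thesis using inj_on_finite[OF i sub C(2)] card_inj_on_le[OF i sub C(2)] by blast
  qed
  then show thesis by (rule that)
qed

lemma finite_fibre: "compact K \<Longrightarrow> finite {\<gamma>\<in>\<Gamma>. x + \<gamma> \<in> K}"
  using fibre_bound[of K] by metis

text \<open>Substituting \<open>- \<gamma>\<close> for \<open>\<gamma>\<close> shows that \<open>\<phi> \<gamma>\<close> is the weight of the right translate of \<open>k\<close> that sits
  at \<open>\<gamma>\<close>. In this form the case \<open>\<phi> = 1\<close> is the sum of \<open>k\<close> over the left coset of \<open>x\<close>.\<close>

definition spread :: "('g \<Rightarrow> complex) \<Rightarrow> ('g \<Rightarrow> complex) \<Rightarrow> 'g \<Rightarrow> complex" where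
  "spread k \<phi> x = (\<Sum>\<^sub>\<infinity>\<gamma>\<in>\<Gamma>. k (x + \<gamma>) * \<phi> (- \<gamma>))"

lemma spread_eq_sum:
  assumes "finite F" "F \<subseteq> \<Gamma>" "\<And>\<gamma>. \<gamma> \<in> \<Gamma> \<Longrightarrow> \<gamma> \<notin> F \<Longrightarrow> k (x + \<gamma>) = 0"
  shows "spread k \<phi> x = (\<Sum>\<gamma>\<in>F. k (x + \<gamma>) * \<phi> (- \<gamma>))"
proof -
  have "spread k \<phi> x = (\<Sum>\<^sub>\<infinity>\<gamma>\<in>F. k (x + \<gamma>) * \<phi> (- \<gamma>))"
    unfolding spread_def by (rule infsum_cong_neutral) (use assms in auto)
  then show ?thesis using assms(1) by simp
qed

lemma spread_fibre:
  assumes "k \<in> CC K" "compact K"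
  shows "spread k \<phi> x = (\<Sum>\<gamma>\<in>{\<gamma>\<in>\<Gamma>. x + \<gamma> \<in> K}. k (x + \<gamma>) * \<phi> (- \<gamma>))"
  by (rule spread_eq_sum) (use finite_fibre[OF assms(2)] CC_zero[OF assms(1)] in auto)

lemma spread_cong: "(\<And>\<gamma>. \<gamma> \<in> \<Gamma> \<Longrightarrow> \<phi> \<gamma> = \<psi> \<gamma>) \<Longrightarrow> spread k \<phi> x = spread k \<psi> x"
  unfolding spread_def by (intro infsum_cong) (simp add: minus_in)

lemma spread_translate: "spread (\<lambda>y. k (a + y)) \<phi> x = spread k \<phi> (a + x)"
  by (simp add: spread_def add.assoc)

lemma spread_add_kernel:
  assumes "k \<in> CC K" "l \<in> CC K" "compact K"
  shows "spread (\<lambda>y. k y + l y) \<phi> x = spread k \<phi> x + spread l \<phi> x"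
proof -
  have "(\<lambda>y. k y + l y) \<in> CC K"
    using assms by (auto simp: CC_def intro: continuous_on_add)
  then show ?thesis using assms
    by (simp add: spread_fibre sum.distrib algebra_simps)
qed

lemma spread_scale_kernel:
  assumes "k \<in> CC K" "compact K"
  shows "spread (\<lambda>y. c * k y) \<phi> x = c * spread k \<phi> x"
proof -
  have "(\<lambda>y. c * k y) \<in> CC K"
    using assms by (auto simp: CC_def intro: continuous_intros)
  then show ?thesis using assms
    by (simp add: spread_fibre sum_distrib_left algebra_simps)
qed

lemma spread_add:
  assumes "k \<in> CC K" "compact K"
  shows "spread k (\<lambda>\<gamma>. \<phi> \<gamma> + \<psi> \<gamma>) x = spread k \<phi> x + spread k \<psi> x"
  using assms by (simp add: spread_fibre sum.distrib algebra_simps)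

lemma spread_scale:
  assumes "k \<in> CC K" "compact K"
  shows "spread k (\<lambda>\<gamma>. c * \<phi> \<gamma>) x = c * spread k \<phi> x"
  using assms by (simp add: spread_fibre sum_distrib_left algebra_simps)

lemma spread_shift:
  assumes "\<delta> \<in> \<Gamma>"
  shows "spread k (\<lambda>\<gamma>. \<phi> (\<delta> + \<gamma>)) x = spread (\<lambda>y. k (y + \<delta>)) \<phi> x"
  unfolding spread_def
proof (rule infsum_reindex_bij_witness[where j = "\<lambda>\<gamma>. \<gamma> + - \<delta>" and i = "\<lambda>\<gamma>. \<gamma> + \<delta>"])
  fix \<gamma> assume g: "\<gamma> \<in> \<Gamma>"
  show "\<gamma> + - \<delta> + \<delta> = \<gamma>" "\<gamma> + \<delta> + - \<delta> = \<gamma>" by (simp_all add: add.assoc)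
  show "\<gamma> + - \<delta> \<in> \<Gamma>" "\<gamma> + \<delta> \<in> \<Gamma>" using g assms add_in minus_in by blast+
  show "k (x + (\<gamma> + - \<delta>) + \<delta>) * \<phi> (- (\<gamma> + - \<delta>)) = k (x + \<gamma>) * \<phi> (\<delta> + - \<gamma>)"
    by (simp add: add.assoc minus_add del: add_uminus_conv_diff)
qed

lemma spread_one_periodic:
  assumes "\<delta> \<in> \<Gamma>"
  shows "spread k (\<lambda>_. c) (x + \<delta>) = spread k (\<lambda>_. c) x"
  unfolding spread_def
proof (rule infsum_reindex_bij_witness[where j = "\<lambda>\<gamma>. \<delta> + \<gamma>" and i = "\<lambda>\<gamma>. - \<delta> + \<gamma>"])
  fix \<gamma> assume g: "\<gamma> \<in> \<Gamma>"
  show "- \<delta> + (\<delta> + \<gamma>) = \<gamma>" "\<delta> + (- \<delta> + \<gamma>) = \<gamma>" by simp_all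
  show "\<delta> + \<gamma> \<in> \<Gamma>" "- \<delta> + \<gamma> \<in> \<Gamma>" using g assms add_in minus_in by blast+
  show "k (x + (\<delta> + \<gamma>)) * c = k (x + \<delta> + \<gamma>) * c" by (simp add: add.assoc)
qed

lemma spread_bound:
  assumes K: "compact K"
  obtains N where "N > 0" "\<And>k \<phi> c d x. k \<in> CC K \<Longrightarrow> (\<And>y. norm (k y) \<le> c) \<Longrightarrow>
     (\<And>\<gamma>. \<gamma> \<in> \<Gamma> \<Longrightarrow> norm (\<phi> \<gamma>) \<le> d) \<Longrightarrow> norm (spread k \<phi> x) \<le> N * (c * d)"
proof -
  obtain n where n: "\<And>x. finite {\<gamma>\<in>\<Gamma>. x + \<gamma> \<in> K} \<and> card {\<gamma>\<in>\<Gamma>. x + \<gamma> \<in> K} \<le> n"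
    using fibre_bound[OF K] by blast
  have "norm (spread k \<phi> x) \<le> (real n + 1) * (c * d)"
    if k: "k \<in> CC K" and c: "\<And>y. norm (k y) \<le> c" and d: "\<And>\<gamma>. \<gamma> \<in> \<Gamma> \<Longrightarrow> norm (\<phi> \<gamma>) \<le> d" for k \<phi> c d x
  proof -
    have cd: "0 \<le> c * d"
      using order_trans[OF norm_ge_zero c] order_trans[OF norm_ge_zero d[OF zero_in]] by simp
    have "norm (spread k \<phi> x) \<le> (\<Sum>\<gamma>\<in>{\<gamma>\<in>\<Gamma>. x + \<gamma> \<in> K}. c * d)"
      unfolding spread_fibre[OF k K]
    proof (rule sum_norm_le)
      fix \<gamma> assume "\<gamma> \<in> {\<gamma>\<in>\<Gamma>. x + \<gamma> \<in> K}"
      then show "norm (k (x + \<gamma>) * \<phi> (- \<gamma>)) \<le> c * d"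
        unfolding norm_mult using c[of "x + \<gamma>"]
        by (intro mult_mono d minus_in c order_trans[OF norm_ge_zero c]) auto
    qed
    also have "\<dots> = real (card {\<gamma>\<in>\<Gamma>. x + \<gamma> \<in> K}) * (c * d)" by simp
    also have "\<dots> \<le> (real n + 1) * (c * d)"
      using n[of x] cd by (intro mult_right_mono) auto
    finally show ?thesis .
  qed
  then show thesis by (intro that[of "real n + 1"]) auto
qed

text \<open>Uniform continuity of the kernel passes to the sum because at most a fixed number of lattice points
  contributes at any point of the group.\<close>

lemma spread_LUC:
  assumes k: "k \<in> CC K" and K: "compact K" and \<phi>: "\<And>\<gamma>. \<gamma> \<in> \<Gamma> \<Longrightarrow> norm (\<phi> \<gamma>) \<le> d"
  shows "spread k \<phi> \<in> LUC"
proof -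
  obtain c where c: "c > 0" "\<And>x. norm (k x) \<le> c" using CC_bounded[OF k K] by blast
  obtain N where N: "N > 0" "\<And>x. norm (spread k \<phi> x) \<le> N * (c * d)"
    using spread_bound[OF K] k c(2) \<phi> by metis
  obtain n where n: "\<And>x. finite {\<gamma>\<in>\<Gamma>. x + \<gamma> \<in> K} \<and> card {\<gamma>\<in>\<Gamma>. x + \<gamma> \<in> K} \<le> n"
    using fibre_bound[OF K] by blast
  have d: "0 \<le> d" using order_trans[OF norm_ge_zero \<phi>[OF zero_in]] .
  show ?thesis
  proof (rule LUC_I[OF N(2)])
    fix e :: real assume e: "e > 0"
    define r where "r = e / ((2 * real n + 1) * (d + 1))"
    have r: "r > 0" unfolding r_def using e d by (intro divide_pos_pos mult_pos_pos) auto
    obtain U where U: "open U" "0 \<in> U" "\<And>u x. u \<in> U \<Longrightarrow> norm (k (u + x) - k x) \<le> r"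
      using CC_left_uniform[OF k K r] by blast
    have "norm (spread k \<phi> (u + x) - spread k \<phi> x) \<le> e" if u: "u \<in> U" for u x
    proof -
      let ?S = "{\<gamma>\<in>\<Gamma>. (u + x) + \<gamma> \<in> K}" and ?T = "{\<gamma>\<in>\<Gamma>. x + \<gamma> \<in> K}"
      have fin: "finite (?S \<union> ?T)" using n by blast
      have "spread k \<phi> (u + x) - spread k \<phi> x =
         (\<Sum>\<gamma>\<in>?S \<union> ?T. k (u + x + \<gamma>) * \<phi> (- \<gamma>)) - (\<Sum>\<gamma>\<in>?S \<union> ?T. k (x + \<gamma>) * \<phi> (- \<gamma>))"
        by (intro arg_cong2[where f = "(-)"] spread_eq_sum fin) (auto intro: CC_zero[OF k])
      also have "\<dots> = (\<Sum>\<gamma>\<in>?S \<union> ?T. (k (u + (x + \<gamma>)) - k (x + \<gamma>)) * \<phi> (- \<gamma>))"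
        by (simp add: sum_subtractf algebra_simps)
      finally have eq: "spread k \<phi> (u + x) - spread k \<phi> x =
        (\<Sum>\<gamma>\<in>?S \<union> ?T. (k (u + (x + \<gamma>)) - k (x + \<gamma>)) * \<phi> (- \<gamma>))" .
      have "norm (spread k \<phi> (u + x) - spread k \<phi> x) \<le>
          (\<Sum>\<gamma>\<in>?S \<union> ?T. norm ((k (u + (x + \<gamma>)) - k (x + \<gamma>)) * \<phi> (- \<gamma>)))"
        unfolding eq by (rule norm_sum)
      also have "\<dots> \<le> (\<Sum>\<gamma>\<in>?S \<union> ?T. r * (d + 1))"
      proof (rule sum_mono)
        fix \<gamma> assume "\<gamma> \<in> ?S \<union> ?T"
        then have "norm (\<phi> (- \<gamma>)) \<le> d + 1" using \<phi>[of "- \<gamma>"] minus_in by auto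
        then show "norm ((k (u + (x + \<gamma>)) - k (x + \<gamma>)) * \<phi> (- \<gamma>)) \<le> r * (d + 1)"
          unfolding norm_mult using U(3)[OF u] r by (intro mult_mono) auto
      qed
      also have "\<dots> = real (card (?S \<union> ?T)) * (r * (d + 1))" by simp
      also have "\<dots> \<le> (2 * real n + 1) * (r * (d + 1))"
      proof (rule mult_right_mono)
        have "card (?S \<union> ?T) \<le> card ?S + card ?T" by (rule card_Un_le)
        also have "\<dots> \<le> n + n" using n[of x] n[of "u + x"] by linarith
        finally show "real (card (?S \<union> ?T)) \<le> 2 * real n + 1" by linarith
      qed (use r d in simp)
      also have "\<dots> = e" unfolding r_def using d by (simp add: field_simps add_nonneg_eq_0_iff)
      finally show ?thesis .
    qed
    then show "\<exists>U. open U \<and> 0 \<in> U \<and> (\<forall>u\<in>U. \<forall>x. norm (spread k \<phi> (u + x) - spread k \<phi> x) \<le> e)"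
      using U(1,2) by blast
  qed
qed

text \<open>The union of the right translates of an open set is open, so the sets \<open>N a\<close> have open images in the
  compact coset space.\<close>

lemma coset_cover:
  fixes N :: "'g \<Rightarrow> 'g set"
  assumes N: "\<And>a. open (N a)" "\<And>a. a \<in> N a"
  obtains A where "finite A" "\<And>x. \<exists>\<gamma>\<in>\<Gamma>. \<exists>a\<in>A. x + \<gamma> \<in> N a"
proof -
  have lcx: "left_coset \<Gamma> x \<in> left_coset \<Gamma> ` S \<longleftrightarrow> (\<exists>\<gamma>\<in>\<Gamma>. x + \<gamma> \<in> S)" for x S
  proof
    assume "left_coset \<Gamma> x \<in> left_coset \<Gamma> ` S"
    then obtain y where y: "y \<in> S" "left_coset \<Gamma> x = left_coset \<Gamma> y" by blast
    have "y \<in> left_coset \<Gamma> x" using y(2) zero_in by (force simp: left_coset_def)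
    then show "\<exists>\<gamma>\<in>\<Gamma>. x + \<gamma> \<in> S" using y(1) by (auto simp: left_coset_def)
  next
    assume "\<exists>\<gamma>\<in>\<Gamma>. x + \<gamma> \<in> S"
    then obtain \<gamma> where g: "\<gamma> \<in> \<Gamma>" "x + \<gamma> \<in> S" by blast
    have "left_coset \<Gamma> x = left_coset \<Gamma> (x + \<gamma>)"
    proof
      show "left_coset \<Gamma> x \<subseteq> left_coset \<Gamma> (x + \<gamma>)"
      proof
        fix z assume "z \<in> left_coset \<Gamma> x"
        then obtain \<eta> where "\<eta> \<in> \<Gamma>" "z = x + \<eta>" by (auto simp: left_coset_def)
        then have "z = (x + \<gamma>) + (- \<gamma> + \<eta>)" "- \<gamma> + \<eta> \<in> \<Gamma>"
          using g(1) add_in minus_in by (auto simp: add.assoc)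
        then show "z \<in> left_coset \<Gamma> (x + \<gamma>)" unfolding left_coset_def by blast
      qed
      show "left_coset \<Gamma> (x + \<gamma>) \<subseteq> left_coset \<Gamma> x"
        using g(1) add_in by (auto simp: left_coset_def add.assoc)
    qed
    then show "left_coset \<Gamma> x \<in> left_coset \<Gamma> ` S" using g(2) by blast
  qed
  let ?\<U> = "range (\<lambda>a. left_coset \<Gamma> ` N a)"
  have "openin (coset_topology \<Gamma>) (left_coset \<Gamma> ` N a)" for a
    unfolding openin_coset_topology
  proof
    have "{x. left_coset \<Gamma> x \<in> left_coset \<Gamma> ` N a} = (\<Union>\<gamma>\<in>\<Gamma>. (\<lambda>x. x + \<gamma>) -` N a)"
      unfolding lcx by auto
    also have "open \<dots>" by (intro open_UN ballI open_vimage N continuous_intros)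
    finally show "open {x. left_coset \<Gamma> x \<in> left_coset \<Gamma> ` N a}" .
  qed auto
  moreover have "topspace (coset_topology \<Gamma>) \<subseteq> \<Union>?\<U>"
    unfolding topspace_coset_topology using N(2) by blast
  moreover have "compact_space (coset_topology \<Gamma>)"
    using uniform by (simp add: uniform_lattice_def)
  ultimately obtain \<F> where F: "finite \<F>" "\<F> \<subseteq> ?\<U>" "topspace (coset_topology \<Gamma>) \<subseteq> \<Union>\<F>"
    unfolding compact_space_alt by (metis (no_types, lifting) imageE)
  then obtain A where A: "finite A" "\<F> = (\<lambda>a. left_coset \<Gamma> ` N a) ` A"
    by (meson finite_subset_image)
  have "\<exists>\<gamma>\<in>\<Gamma>. \<exists>a\<in>A. x + \<gamma> \<in> N a" for x
  proof -
    have "left_coset \<Gamma> x \<in> \<Union>\<F>" using F(3) unfolding topspace_coset_topology by blast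
    then obtain a where "a \<in> A" "left_coset \<Gamma> x \<in> left_coset \<Gamma> ` N a" using A(2) by blast
    then show ?thesis unfolding lcx by blast
  qed
  with A(1) show thesis by (rule that)
qed

section \<open>Integration over the coset space\<close>

text \<open>Continuous functions on the coset space, as functions on the group.\<close>

definition periodic :: "('g \<Rightarrow> complex) set" where
  "periodic = {F. continuous_on UNIV F \<and> (\<forall>x. \<forall>\<gamma>\<in>\<Gamma>. F (x + \<gamma>) = F x)}"

definition coset_integral :: "('g \<Rightarrow> complex) \<Rightarrow> complex" where
  "coset_integral F = (LINT C|\<nu>. F (SOME x. left_coset \<Gamma> x = C))"

lemma periodic_cont: "F \<in> periodic \<Longrightarrow> continuous_on UNIV F"
  and periodic_shift: "F \<in> periodic \<Longrightarrow> \<gamma> \<in> \<Gamma> \<Longrightarrow> F (x + \<gamma>) = F x"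
  by (auto simp: periodic_def)

lemma periodic_const: "(\<lambda>_. c) \<in> periodic"
  by (simp add: periodic_def)

lemma periodic_add: "F \<in> periodic \<Longrightarrow> G \<in> periodic \<Longrightarrow> (\<lambda>x. F x + G x) \<in> periodic"
  by (auto simp: periodic_def intro: continuous_on_add)

lemma periodic_scale: "F \<in> periodic \<Longrightarrow> (\<lambda>x. c * F x) \<in> periodic"
  by (auto simp: periodic_def intro: continuous_on_mult_left)

lemma periodic_translate: "F \<in> periodic \<Longrightarrow> (\<lambda>x. F (a + x)) \<in> periodic"
  by (auto simp: periodic_def add.assoc[symmetric]
      intro!: continuous_on_compose2[of UNIV F UNIV "\<lambda>x. a + x"] continuous_on_add continuous_on_const continuous_on_id)

lemma periodic_spread:
  assumes "k \<in> CC K" "compact K"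
  shows "spread k (\<lambda>_. c) \<in> periodic"
  unfolding periodic_def
  using LUC_cont[OF spread_LUC[OF assms, of "\<lambda>_. c" "norm c"]] spread_one_periodic by simp

lemma left_coset_eqD: "left_coset \<Gamma> x = left_coset \<Gamma> y \<Longrightarrow> \<exists>\<gamma>\<in>\<Gamma>. x = y + \<gamma>"
proof -
  assume e: "left_coset \<Gamma> x = left_coset \<Gamma> y"
  have "x + 0 \<in> left_coset \<Gamma> x" unfolding left_coset_def using zero_in by blast
  then show ?thesis unfolding e by (auto simp: left_coset_def)
qed

lemma periodic_rep:
  assumes "F \<in> periodic" 
  shows "F (SOME y. left_coset \<Gamma> y = left_coset \<Gamma> x) = F x"
proof -
  have "left_coset \<Gamma> (SOME y. left_coset \<Gamma> y = left_coset \<Gamma> x) = left_coset \<Gamma> x"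
    by (rule someI[of _ x]) simp
  then obtain \<gamma> where "\<gamma> \<in> \<Gamma>" "(SOME y. left_coset \<Gamma> y = left_coset \<Gamma> x) = x + \<gamma>"
    using left_coset_eqD by blast
  then show ?thesis using periodic_shift[OF assms] by simp
qed

lemma periodic_bounded:
  assumes F: "F \<in> periodic"
  obtains c where "\<And>x. norm (F x) \<le> c"
proof -
  define N where "N a = {x. norm (F x - F a) < 1}" for a
  have "open (N a)" for a
    unfolding N_def by (intro open_Collect_less continuous_intros periodic_cont[OF F])
  moreover have "a \<in> N a" for a by (simp add: N_def)
  ultimately obtain A where A: "finite A" "\<And>x. \<exists>\<gamma>\<in>\<Gamma>. \<exists>a\<in>A. x + \<gamma> \<in> N a"
    using coset_cover[of N] by blast
  have "norm (F x) \<le> 1 + (\<Sum>a\<in>A. norm (F a))" for x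
  proof -
    obtain \<gamma> a where g: "\<gamma> \<in> \<Gamma>" "a \<in> A" "x + \<gamma> \<in> N a" using A(2) by blast
    have "norm (F x) \<le> norm (F x - F a) + norm (F a)"
      by (metis diff_add_cancel norm_triangle_ineq)
    moreover have "norm (F x - F a) < 1"
      using g(3) periodic_shift[OF F g(1)] by (simp add: N_def)
    moreover have "norm (F a) \<le> (\<Sum>a\<in>A. norm (F a))"
      by (rule member_le_sum) (use g A(1) in auto)
    ultimately show ?thesis by linarith
  qed
  then show thesis by (rule that)
qed

lemma space_nu: "space \<nu> = range (left_coset \<Gamma>)"
  and sets_nu: "sets \<nu> = sigma_sets (range (left_coset \<Gamma>)) {U. openin (coset_topology \<Gamma>) U}"
  and nu_one: "emeasure \<nu> (space \<nu>) = 1"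
  and nu_invariant: "B \<in> sets \<nu> \<Longrightarrow> emeasure \<nu> ((`) ((+) x) ` B) = emeasure \<nu> B"
  using inv_prob
  unfolding invariant_radon_probability_def radon_measure_def topspace_coset_topology by auto

lemma open_sets_nu: "openin (coset_topology \<Gamma>) S \<Longrightarrow> S \<in> sets \<nu>"
  unfolding sets_nu by (rule sigma_sets.Basic) simp

lemma periodic_measurable:
  assumes F: "F \<in> periodic"
  shows "(\<lambda>C. F (SOME x. left_coset \<Gamma> x = C)) \<in> borel_measurable \<nu>"
proof (rule borel_measurableI)
  fix S :: "complex set" assume S: "open S"
  let ?P = "(\<lambda>C. F (SOME x. left_coset \<Gamma> x = C)) -` S \<inter> space \<nu>"
  have "{x. left_coset \<Gamma> x \<in> ?P} = F -` S"
    by (auto simp: space_nu periodic_rep[OF F])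
  moreover have "open (F -` S)" by (rule open_vimage[OF S periodic_cont[OF F]])
  ultimately have "openin (coset_topology \<Gamma>) ?P"
    unfolding openin_coset_topology by (simp add: space_nu)
  then show "?P \<in> sets \<nu>" by (rule open_sets_nu)
qed

lemma periodic_integrable:
  assumes F: "F \<in> periodic"
  shows "integrable \<nu> (\<lambda>C. F (SOME x. left_coset \<Gamma> x = C))"
proof -
  interpret finite_measure \<nu> by (rule finite_measureI) (simp add: nu_one)
  obtain c where "\<And>x. norm (F x) \<le> c" using periodic_bounded[OF F] by blast
  then show ?thesis
    by (intro integrable_const_bound[where B = c] periodic_measurable F) auto
qed

lemma coset_integral_add:
  "F \<in> periodic \<Longrightarrow> G \<in> periodic \<Longrightarrow>
    coset_integral (\<lambda>x. F x + G x) = coset_integral F + coset_integral G"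
  unfolding coset_integral_def by (intro Bochner_Integration.integral_add periodic_integrable)

lemma coset_integral_scale: "coset_integral (\<lambda>x. c * F x) = c * coset_integral F"
  unfolding coset_integral_def by simp

lemma coset_integral_const: "coset_integral (\<lambda>_. c) = c"
proof -
  have "measure \<nu> (space \<nu>) = 1" by (simp add: measure_def nu_one)
  then show ?thesis unfolding coset_integral_def by simp
qed

lemma coset_integral_of_real:
  "coset_integral (\<lambda>x. of_real (g x)) = of_real (Re (coset_integral (\<lambda>x. of_real (g x))))"
  unfolding coset_integral_def integral_complex_of_real by simp

lemma coset_integral_mono:
  assumes F: "F \<in> periodic" and g: "(\<lambda>x. of_real (g x)) \<in> periodic"
    and le: "\<And>x. norm (F x) \<le> g x"
  shows "norm (coset_integral F) \<le> Re (coset_integral (\<lambda>x. of_real (g x)))"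
proof -
  let ?r = "\<lambda>C. SOME x. left_coset \<Gamma> x = C"
  have ig: "integrable \<nu> (\<lambda>C. g (?r C))"
    using integrable_Re[OF periodic_integrable[OF g]] by simp
  have "norm (coset_integral F) \<le> (LINT C|\<nu>. norm (F (?r C)))"
    unfolding coset_integral_def by (rule integral_norm_bound)
  also have "\<dots> \<le> (LINT C|\<nu>. g (?r C))"
    by (rule integral_mono[OF integrable_norm[OF periodic_integrable[OF F]] ig]) (rule le)
  finally show ?thesis unfolding coset_integral_def by simp
qed

lemma coset_integral_bound:
  assumes "F \<in> periodic" "\<And>x. norm (F x) \<le> c"
  shows "norm (coset_integral F) \<le> c"
  using coset_integral_mono[OF assms(1) periodic_const[of "of_real c"] assms(2)]
  by (simp add: coset_integral_const)

lemma coset_integral_pos: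
  assumes "F \<in> periodic" "\<And>x. F x \<in> \<real>\<^sub>\<ge>\<^sub>0"
  shows "coset_integral F \<in> \<real>\<^sub>\<ge>\<^sub>0"
proof -
  have F: "F = (\<lambda>x. of_real (Re (F x)))"
    using assms(2) by (auto simp: fun_eq_iff complex_eq_iff complex_nonneg_Reals_iff)
  have "norm (coset_integral (\<lambda>_. 0)) \<le> Re (coset_integral (\<lambda>x. of_real (Re (F x))))"
    using assms F by (intro coset_integral_mono periodic_const) (auto simp: complex_nonneg_Reals_iff)
  then have "0 \<le> Re (coset_integral F)" unfolding F[symmetric] by (rule order_trans[OF norm_ge_zero])
  moreover have "Im (coset_integral F) = 0"
    using arg_cong[OF coset_integral_of_real[of "\<lambda>x. Re (F x)"], of Im] F by simp
  ultimately show ?thesis by (simp add: complex_nonneg_Reals_iff)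
qed

text \<open>Translation by \<open>a\<close> acts on cosets as a measurable bijection that preserves \<open>\<nu>\<close>. The chosen
  representatives do not move along, but periodic functions do not see the difference.\<close>

lemma coset_integral_translate:
  assumes F: "F \<in> periodic"
  shows "coset_integral (\<lambda>x. F (a + x)) = coset_integral F"
proof -
  let ?r = "\<lambda>C. SOME x. left_coset \<Gamma> x = C"
  define T where "T = (`) ((+) a)"
  have T: "T (left_coset \<Gamma> x) = left_coset \<Gamma> (a + x)" for x
    by (simp add: T_def left_coset_def image_image add.assoc)
  have T_meas: "T \<in> measurable \<nu> \<nu>"
  proof (rule measurable_sigma_sets[OF sets_nu])
    show "{U. openin (coset_topology \<Gamma>) U} \<subseteq> Pow (range (left_coset \<Gamma>))"
      by (auto simp: openin_coset_topology)
    show "T \<in> space \<nu> \<rightarrow> range (left_coset \<Gamma>)" by (auto simp: space_nu T)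
    fix S assume "S \<in> {U. openin (coset_topology \<Gamma>) U}"
    then have S: "open {x. left_coset \<Gamma> x \<in> S}" by (simp add: openin_coset_topology)
    have "{x. left_coset \<Gamma> x \<in> T -` S \<inter> space \<nu>} = (\<lambda>x. a + x) -` {x. left_coset \<Gamma> x \<in> S}"
      by (auto simp: space_nu T)
    also have "open \<dots>" by (intro open_vimage S continuous_intros)
    finally show "T -` S \<inter> space \<nu> \<in> sets \<nu>"
      by (intro open_sets_nu) (simp add: openin_coset_topology space_nu)
  qed
  have distr: "distr \<nu> \<nu> T = \<nu>"
  proof (rule measure_eqI)
    fix B assume "B \<in> sets (distr \<nu> \<nu> T)"
    then have B: "B \<in> sets \<nu>" by simp
    have pre: "T -` B \<inter> space \<nu> \<in> sets \<nu>" by (rule measurable_sets[OF T_meas B])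
    have "C \<in> T ` (T -` B \<inter> space \<nu>)" if "C \<in> B" for C
    proof -
      have "C \<in> space \<nu>" using sets.sets_into_space[OF B] that by blast
      then obtain x where x: "C = left_coset \<Gamma> x" unfolding space_nu by blast
      then have "C = T (left_coset \<Gamma> (- a + x))" by (simp add: T)
      then show ?thesis using that by (auto simp: space_nu)
    qed
    then have "T ` (T -` B \<inter> space \<nu>) = B" by blast
    then show "emeasure (distr \<nu> \<nu> T) B = emeasure \<nu> B"
      using emeasure_distr[OF T_meas B] nu_invariant[OF pre, of a] by (simp add: T_def)
  qed simp
  have "coset_integral F = (LINT C|distr \<nu> \<nu> T. F (?r C))"
    by (simp add: coset_integral_def distr)
  also have "\<dots> = (LINT C|\<nu>. F (?r (T C)))"
    by (rule integral_distr[OF T_meas periodic_measurable[OF F]])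
  also have "\<dots> = coset_integral (\<lambda>x. F (a + x))"
    unfolding coset_integral_def
  proof (rule Bochner_Integration.integral_cong[OF refl])
    fix C assume "C \<in> space \<nu>"
    then obtain x where x: "C = left_coset \<Gamma> x" by (auto simp: space_nu)
    show "F (?r (T C)) = F (a + ?r C)"
      unfolding x T periodic_rep[OF F] periodic_rep[OF periodic_translate[OF F]] ..
  qed
  finally show ?thesis by simp
qed

lemma coset_integral_sum:
  assumes "finite A" "\<And>a. a \<in> A \<Longrightarrow> F a \<in> periodic"
  shows "(\<lambda>x. \<Sum>a\<in>A. F a x) \<in> periodic \<and>
    coset_integral (\<lambda>x. \<Sum>a\<in>A. F a x) = (\<Sum>a\<in>A. coset_integral (F a))"
  using assms
proof (induction A rule: finite_induct)
  case empty
  then show ?case by (simp add: periodic_const coset_integral_const)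
next
  case (insert a A)
  have fa: "F a \<in> periodic" and IH: "(\<lambda>x. \<Sum>a\<in>A. F a x) \<in> periodic"
    "coset_integral (\<lambda>x. \<Sum>a\<in>A. F a x) = (\<Sum>a\<in>A. coset_integral (F a))"
    using insert by blast+
  show ?case
    using periodic_add[OF fa IH(1)] coset_integral_add[OF fa IH(1)] IH(2) insert.hyps by simp
qed

section \<open>The lifted Haar integral, partitions of unity and quadrature\<close>

text \<open>This is a Haar integral: invariance on the left comes from \<open>\<nu>\<close>.\<close>

definition haar :: "('g \<Rightarrow> complex) \<Rightarrow> complex" where
  "haar k = coset_integral (spread k (\<lambda>_. 1))"

text \<open>A partition of unity modulo \<open>\<Gamma>\<close>.\<close>

definition partition :: "'g set \<Rightarrow> 'g set \<Rightarrow> ('g \<Rightarrow> 'g \<Rightarrow> complex) \<Rightarrow> bool" where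
  "partition U A b \<longleftrightarrow> finite A \<and> (\<forall>a\<in>A. \<exists>K. compact K \<and> b a \<in> CC K) \<and> (\<forall>a x. b a x \<in> \<real>\<^sub>\<ge>\<^sub>0) \<and>
     (\<forall>a x. b a x \<noteq> 0 \<longrightarrow> x - a \<in> U) \<and> (\<forall>x. (\<Sum>a\<in>A. spread (b a) (\<lambda>_. 1) x) = 1)"

text \<open>Right translates of a bump function are divided by their total sum over cosets. That sum is
  periodic, so the division commutes with summation over cosets.\<close>

lemma partition_exists:
  assumes U: "open U" "0 \<in> U"
  obtains A b where "partition U A b"
proof -
  obtain h :: "'g \<Rightarrow> real" and K where h: "compact K" "continuous_on UNIV h"
    "\<And>x. 0 \<le> h x" "h 0 = 1" "\<And>x. x \<notin> K \<Longrightarrow> h x = 0" "\<And>x. x \<notin> U \<Longrightarrow> h x = 0"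
    using symmetric_bump[OF lc U] by metis
  define N where "N a = {x. 0 < h (x - a)}" for a
  have ch: "continuous_on UNIV (\<lambda>x. h (x - a))" for a
    by (rule continuous_on_compose2[OF h(2)]) (auto intro: continuous_on_diff continuous_on_id continuous_on_const)
  have "open (N a)" "a \<in> N a" for a
    unfolding N_def using h(4) by (auto intro: open_Collect_less ch continuous_on_const)
  then obtain A where A: "finite A" "\<And>x. \<exists>\<gamma>\<in>\<Gamma>. \<exists>a\<in>A. x + \<gamma> \<in> N a"
    using coset_cover[of N] by blast
  define k where "k a x = complex_of_real (h (x - a))" for a x
  define L where "L a = (\<lambda>x. x + a) ` K" for a
  have L: "compact (L a)" for a unfolding L_def by (rule compact_translate[OF h(1)])
  have hL: "h (x - a) = 0" if "x \<notin> L a" for x a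
  proof (rule h(5))
    have "x = (x - a) + a" by simp
    then show "x - a \<notin> K" using that unfolding L_def by blast
  qed
  have k: "k a \<in> CC (L a)" for a
    unfolding CC_def k_def using hL ch by (auto intro!: continuous_on_of_real)
  define q where "q x = (\<Sum>a\<in>A. \<Sum>\<gamma>\<in>{\<gamma>\<in>\<Gamma>. x + \<gamma> \<in> L a}. h (x + \<gamma> - a))" for x
  define Q where "Q x = (\<Sum>a\<in>A. spread (k a) (\<lambda>_. 1) x)" for x
  have Q: "Q x = of_real (q x)" for x
    unfolding Q_def q_def by (simp add: spread_fibre[OF k L] k_def)
  have "Q \<in> periodic"
    using coset_integral_sum[OF A(1), of "\<lambda>a. spread (k a) (\<lambda>_. 1)"] periodic_spread[OF k L]
    unfolding Q_def by blast
  then have cq: "continuous_on UNIV q" and pq: "\<And>x \<gamma>. \<gamma> \<in> \<Gamma> \<Longrightarrow> Q (x + \<gamma>) = Q x"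
    using continuous_on_Re[of UNIV Q] by (auto simp: periodic_def Q)
  have q: "q x > 0" for x
  proof -
    obtain \<gamma> a where g: "\<gamma> \<in> \<Gamma>" "a \<in> A" "0 < h (x + \<gamma> - a)" using A(2)[of x] by (auto simp: N_def)
    have "x + \<gamma> \<in> L a" using g(3) hL[of "x + \<gamma>" a] by auto
    then have "0 < (\<Sum>\<gamma>\<in>{\<gamma>\<in>\<Gamma>. x + \<gamma> \<in> L a}. h (x + \<gamma> - a))"
      by (intro sum_pos2[where i = \<gamma>] finite_fibre L g(3) h(3)) (use g in auto)
    then show ?thesis
      unfolding q_def by (intro sum_pos2[OF A(1) g(2)] sum_nonneg h(3)) auto
  qed
  define b where "b a x = complex_of_real (h (x - a) / q x)" for a x
  have b: "b a \<in> CC (L a)" for a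
  proof -
    have "q x \<noteq> 0" for x using q[of x] by simp
    then have "continuous_on UNIV (b a)"
      unfolding b_def by (intro continuous_on_of_real continuous_on_divide ch cq) auto
    then show ?thesis using hL by (auto simp: CC_def b_def)
  qed
  have sb: "spread (b a) (\<lambda>_. 1) x = spread (k a) (\<lambda>_. 1) x / Q x" for a x
  proof -
    have "b a (x + \<gamma>) = k a (x + \<gamma>) / Q x" if "\<gamma> \<in> \<Gamma>" for \<gamma>
      using pq[OF that, of x] by (simp add: b_def k_def Q[of "x + \<gamma>", symmetric])
    then show ?thesis
      by (simp add: spread_fibre[OF k L] spread_fibre[OF b L] sum_divide_distrib)
  qed
  have "Q x \<noteq> 0" for x using q[of x] by (simp add: Q)
  then have "(\<Sum>a\<in>A. spread (b a) (\<lambda>_. 1) x) = 1" for x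
    unfolding sb sum_divide_distrib[symmetric] Q_def[symmetric] by simp
  moreover have "b a x \<in> \<real>\<^sub>\<ge>\<^sub>0" for a x
    using h(3) q[of x] by (simp add: b_def complex_nonneg_Reals_iff less_imp_le)
  moreover have "x - a \<in> U" if "b a x \<noteq> 0" for a x
    using that h(6)[of "x - a"] by (auto simp: b_def)
  moreover have "\<exists>K. compact K \<and> b a \<in> CC K" for a
    using b[of a] L[of a] by blast
  ultimately have "partition U A b"
    unfolding partition_def using A(1) by simp
  then show thesis by (rule that)
qed

text \<open>A weighted average of numbers close to \<open>z\<close> is close to \<open>z\<close>.\<close>

lemma partition_approx:
  assumes p: "partition U A b"
    and close: "\<And>a \<gamma>. a \<in> A \<Longrightarrow> \<gamma> \<in> \<Gamma> \<Longrightarrow> x + \<gamma> - a \<in> U \<Longrightarrow> norm (z - \<phi> a (- \<gamma>)) \<le> e"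
  shows "norm (z - (\<Sum>a\<in>A. spread (b a) (\<phi> a) x)) \<le> e"
proof -
  have "\<forall>a\<in>A. \<exists>K. compact K \<and> b a \<in> CC K" using p by (simp add: partition_def)
  then obtain K where K: "\<And>a. a \<in> A \<Longrightarrow> compact (K a)" "\<And>a. a \<in> A \<Longrightarrow> b a \<in> CC (K a)" by metis
  let ?S = "\<lambda>a. {\<gamma>\<in>\<Gamma>. x + \<gamma> \<in> K a}"
  have sp: "spread (b a) \<psi> x = (\<Sum>\<gamma>\<in>?S a. b a (x + \<gamma>) * \<psi> (- \<gamma>))" if "a \<in> A" for a \<psi>
    by (rule spread_fibre) (use K that in auto)
  have one: "(\<Sum>a\<in>A. \<Sum>\<gamma>\<in>?S a. b a (x + \<gamma>)) = 1"
  proof -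
    have "(\<Sum>a\<in>A. spread (b a) (\<lambda>_. 1) x) = 1" using p unfolding partition_def by blast
    then show ?thesis by (simp add: sp)
  qed
  have "z - (\<Sum>a\<in>A. spread (b a) (\<phi> a) x) = (\<Sum>a\<in>A. \<Sum>\<gamma>\<in>?S a. b a (x + \<gamma>)) * z
      - (\<Sum>a\<in>A. \<Sum>\<gamma>\<in>?S a. b a (x + \<gamma>) * \<phi> a (- \<gamma>))"
    by (simp add: sp one)
  also have "\<dots> = (\<Sum>a\<in>A. \<Sum>\<gamma>\<in>?S a. b a (x + \<gamma>) * (z - \<phi> a (- \<gamma>)))"
    by (simp add: sum_distrib_right right_diff_distrib sum_subtractf)
  also have "norm \<dots> \<le> (\<Sum>a\<in>A. \<Sum>\<gamma>\<in>?S a. Re (b a (x + \<gamma>)) * e)"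
  proof (intro sum_norm_le)
    fix a \<gamma> assume a: "a \<in> A" and g: "\<gamma> \<in> ?S a"
    have nn: "b a (x + \<gamma>) \<in> \<real>\<^sub>\<ge>\<^sub>0" and sub: "b a (x + \<gamma>) \<noteq> 0 \<Longrightarrow> x + \<gamma> - a \<in> U"
      using p by (auto simp: partition_def)
    have re: "norm (b a (x + \<gamma>)) = Re (b a (x + \<gamma>))"
      using nn by (simp add: complex_nonneg_Reals_iff cmod_eq_Re)
    show "norm (b a (x + \<gamma>) * (z - \<phi> a (- \<gamma>))) \<le> Re (b a (x + \<gamma>)) * e"
    proof (cases "b a (x + \<gamma>) = 0")
      case False
      then show ?thesis unfolding norm_mult re
        using close[OF a _ sub] g nn by (intro mult_left_mono) (auto simp: complex_nonneg_Reals_iff)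
    qed simp
  qed
  also have "\<dots> = Re (\<Sum>a\<in>A. \<Sum>\<gamma>\<in>?S a. b a (x + \<gamma>)) * e"
    by (simp add: sum_distrib_right)
  also have "\<dots> = e" by (simp add: one)
  finally show ?thesis .
qed

text \<open>Every function with the prescribed modulus of continuity is integrated by the same nodes and
  weights. Applied to all functions of a family at once, this replaces Fubini's theorem.\<close>

lemma quadrature:
  assumes p: "partition U A b" and F: "F \<in> periodic"
    and close: "\<And>u x. u \<in> U \<Longrightarrow> norm (F (u + x) - F x) \<le> e"
  shows "norm (coset_integral F - (\<Sum>a\<in>A. haar (b a) * F a)) \<le> e"
proof -
  have "\<forall>a\<in>A. \<exists>K. compact K \<and> b a \<in> CC K" and fin: "finite A"
    using p by (simp_all add: partition_def)
  then obtain K where K: "\<And>a. a \<in> A \<Longrightarrow> compact (K a)" "\<And>a. a \<in> A \<Longrightarrow> b a \<in> CC (K a)" by metis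
  define R where "R x = (\<Sum>a\<in>A. F a * spread (b a) (\<lambda>_. 1) x)" for x
  have per: "(\<lambda>x. F a * spread (b a) (\<lambda>_. 1) x) \<in> periodic" if "a \<in> A" for a
    by (intro periodic_scale periodic_spread[OF K(2,1)] that)
  have R: "R \<in> periodic" "coset_integral R = (\<Sum>a\<in>A. haar (b a) * F a)"
    using coset_integral_sum[of A "\<lambda>a x. F a * spread (b a) (\<lambda>_. 1) x", OF fin per]
    unfolding R_def haar_def coset_integral_scale by (auto simp: mult.commute)
  have R': "R x = (\<Sum>a\<in>A. spread (b a) (\<lambda>_. F a) x)" for x
    unfolding R_def
  proof (rule sum.cong[OF refl])
    fix a assume a: "a \<in> A"
    show "F a * spread (b a) (\<lambda>_. 1) x = spread (b a) (\<lambda>_. F a) x"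
      using spread_scale[OF K(2)[OF a] K(1)[OF a], of "F a" "\<lambda>_. 1" x] by simp
  qed
  have per': "(\<lambda>x. F x + (-1) * R x) \<in> periodic"
    by (intro periodic_add periodic_scale F R)
  have "norm (F x - R x) \<le> e" for x
    unfolding R'
  proof (rule partition_approx[OF p])
    fix a \<gamma> assume g: "\<gamma> \<in> \<Gamma>" "x + \<gamma> - a \<in> U"
    have "norm (F ((x + \<gamma> - a) + a) - F a) \<le> e" by (rule close[OF g(2)])
    then show "norm (F x - F a) \<le> e" by (simp add: periodic_shift[OF F g(1)])
  qed
  then have "norm (coset_integral (\<lambda>x. F x + (-1) * R x)) \<le> e"
    by (intro coset_integral_bound per') simp
  then show ?thesis
    unfolding coset_integral_add[OF F periodic_scale[OF R(1)]] coset_integral_scale R(2) by simp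
qed

section \<open>Uniqueness of the Haar integral\<close>

lemma haar_translate:
  assumes "k \<in> CC K" "compact K"
  shows "haar (\<lambda>x. k (a + x)) = haar k"
  unfolding haar_def spread_translate[abs_def]
  by (rule coset_integral_translate[OF periodic_spread[OF assms]])

lemma haar_scale:
  assumes "k \<in> CC K" "compact K"
  shows "haar (\<lambda>x. c * k x) = c * haar k"
  unfolding haar_def spread_scale_kernel[OF assms, abs_def] coset_integral_scale ..

lemma haar_add:
  assumes "k \<in> CC K" "l \<in> CC K" "compact K"
  shows "haar (\<lambda>x. k x + l x) = haar k + haar l"
  unfolding haar_def spread_add_kernel[OF assms, abs_def]
  by (intro coset_integral_add periodic_spread[OF _ assms(3)] assms)

lemma spread_of_real:
  assumes "(\<lambda>x. of_real (h x)) \<in> CC K" "compact K"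
  shows "spread (\<lambda>x. of_real (h x)) (\<lambda>_. 1) x = of_real (\<Sum>\<gamma>\<in>{\<gamma>\<in>\<Gamma>. x + \<gamma> \<in> K}. h (x + \<gamma>))"
  by (simp add: spread_fibre[OF assms])

lemma haar_mono:
  assumes k: "k \<in> CC K" and h: "(\<lambda>x. of_real (h x)) \<in> CC K" and K: "compact K"
    and le: "\<And>x. norm (k x) \<le> h x"
  shows "norm (haar k) \<le> Re (haar (\<lambda>x. of_real (h x)))"
proof -
  have "norm (haar k) \<le> Re (coset_integral (\<lambda>x. of_real (\<Sum>\<gamma>\<in>{\<gamma>\<in>\<Gamma>. x + \<gamma> \<in> K}. h (x + \<gamma>))))"
    unfolding haar_def
  proof (rule coset_integral_mono[OF periodic_spread[OF k K]])
    show "(\<lambda>x. of_real (\<Sum>\<gamma>\<in>{\<gamma>\<in>\<Gamma>. x + \<gamma> \<in> K}. h (x + \<gamma>))) \<in> periodic"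
      using periodic_spread[OF h K, of 1] unfolding spread_of_real[OF h K, abs_def] .
    show "norm (spread k (\<lambda>_. 1) x) \<le> (\<Sum>\<gamma>\<in>{\<gamma>\<in>\<Gamma>. x + \<gamma> \<in> K}. h (x + \<gamma>))" for x
      unfolding spread_fibre[OF k K] by (rule sum_norm_le) (simp add: le)
  qed
  then show ?thesis unfolding haar_def spread_of_real[OF h K, abs_def] .
qed

lemma haar_of_real:
  assumes h: "(\<lambda>x. of_real (h x)) \<in> CC K" and K: "compact K"
  shows "haar (\<lambda>x. of_real (h x)) = of_real (Re (haar (\<lambda>x. of_real (h x))))"
  unfolding haar_def spread_of_real[OF h K, abs_def] by (rule coset_integral_of_real)

text \<open>On every coset one of finitely many left translates of \<open>h\<close> exceeds \<open>1/2\<close> somewhere, and the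
  translates all have the same integral.\<close>

lemma haar_bump_pos:
  assumes h: "(\<lambda>x. of_real (h x)) \<in> CC K" and K: "compact K" and nn: "\<And>x. 0 \<le> h x" and h0: "h 0 = 1"
    and ch: "continuous_on UNIV h"
  shows "0 < Re (haar (\<lambda>x. of_real (h x)))"
proof -
  define N where "N a = {x. 1/2 < h (- a + x)}" for a
  have "open (N a)" for a
    unfolding N_def by (intro open_Collect_less continuous_on_const continuous_on_translate ch)
  moreover have "a \<in> N a" for a by (simp add: N_def h0)
  ultimately obtain A where A: "finite A" "\<And>x. \<exists>\<gamma>\<in>\<Gamma>. \<exists>a\<in>A. x + \<gamma> \<in> N a"
    using coset_cover[of N] by blast
  define L where "L a = (\<lambda>x. a + x) ` K" for a
  have L: "compact (L a)" for a unfolding L_def by (rule compact_translate[OF K])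
  define k where "k a = (\<lambda>x. complex_of_real (h (- a + x)))" for a
  have k: "k a \<in> CC (L a)" for a
    using CC_left_translate[OF h, of "- a"] by (simp add: L_def k_def)
  define g where "g x = (\<Sum>a\<in>A. \<Sum>\<gamma>\<in>{\<gamma>\<in>\<Gamma>. x + \<gamma> \<in> L a}. h (- a + (x + \<gamma>)))" for x
  have g: "(\<lambda>x. \<Sum>a\<in>A. spread (k a) (\<lambda>_. 1) x) = (\<lambda>x. of_real (g x))"
    unfolding spread_fibre[OF k L] by (simp add: g_def k_def)
  have J: "(\<lambda>x. of_real (g x)) \<in> periodic"
    "coset_integral (\<lambda>x. of_real (g x)) = (\<Sum>a\<in>A. haar (k a))"
    using coset_integral_sum[OF A(1), of "\<lambda>a. spread (k a) (\<lambda>_. 1)"] periodic_spread[OF k L]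
    unfolding g haar_def by blast+
  have "haar (k a) = haar (\<lambda>x. of_real (h x))" for a
    unfolding k_def by (rule haar_translate[OF h K])
  then have J': "coset_integral (\<lambda>x. of_real (g x)) = of_nat (card A) * haar (\<lambda>x. of_real (h x))"
    using J(2) by simp
  have ge: "1/2 \<le> g x" for x
  proof -
    obtain \<gamma> a where c: "\<gamma> \<in> \<Gamma>" "a \<in> A" "1/2 < h (- a + (x + \<gamma>))" using A(2)[of x] by (auto simp: N_def)
    have "x + \<gamma> \<in> L a"
      using c(3) CC_zero[OF k, of "x + \<gamma>" a] unfolding k_def by auto
    then have "h (- a + (x + \<gamma>)) \<le> (\<Sum>\<gamma>\<in>{\<gamma>\<in>\<Gamma>. x + \<gamma> \<in> L a}. h (- a + (x + \<gamma>)))"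
      by (intro member_le_sum[where f = "\<lambda>\<gamma>. h (- a + (x + \<gamma>))"] finite_fibre L nn) (use c in auto)
    also have "\<dots> \<le> g x"
      unfolding g_def
      by (rule member_le_sum[where f = "\<lambda>a. \<Sum>\<gamma>\<in>{\<gamma>\<in>\<Gamma>. x + \<gamma> \<in> L a}. h (- a + (x + \<gamma>))", OF c(2) _ A(1)])
        (intro sum_nonneg nn)
    finally show ?thesis using c(3) by linarith
  qed
  have "norm (coset_integral (\<lambda>_. 1/2)) \<le> Re (coset_integral (\<lambda>x. of_real (g x)))"
    by (rule coset_integral_mono[OF periodic_const J(1)]) (use ge in simp)
  then have "1/2 \<le> real (card A) * Re (haar (\<lambda>x. of_real (h x)))"
    unfolding J' by (simp add: coset_integral_const)
  then show ?thesis
    by (smt (verit, best) mult_nonneg_nonpos of_nat_0_le_iff divide_pos_pos)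
qed

text \<open>The symmetry is what makes the kernel \<open>h (- y + x)\<close> symmetric in \<open>x\<close> and \<open>y\<close>.\<close>

definition bump :: "'g set \<Rightarrow> ('g \<Rightarrow> real) \<Rightarrow> bool" where
  "bump U h \<longleftrightarrow> (\<exists>L. compact L \<and> (\<lambda>x. complex_of_real (h x)) \<in> CC L) \<and> (\<forall>x. 0 \<le> h x) \<and>
     (\<forall>x. h (- x) = h x) \<and> (\<forall>x. x \<notin> U \<longrightarrow> h x = 0)"

text \<open>Consider \<open>f(y) h(- y + x)\<close> for a bump \<open>h\<close> near \<open>0\<close>. Integrated over \<open>y\<close> it gives nearly
  \<open>f(x)\<close> times the integral of \<open>h\<close>, since the symmetry of \<open>h\<close> and left invariance turn the integral
  into that of \<open>f(x + y) h(y)\<close>. On the other hand, as a function of \<open>x\<close> the integral is nearly a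
  finite combination of left translates of \<open>h\<close>, on each of which \<open>I\<close> has the value \<open>I h\<close>; the
  coefficients add up to nearly \<open>haar f\<close>. Comparing the two gives the estimate.\<close>

lemma haar_comparison:
  assumes I: "invariant_functional I" and f: "f \<in> CC K" and K: "compact K" and e: "e > 0"
  obtains U where "open U" "0 \<in> U"
    "\<And>h. bump U h \<Longrightarrow> norm (I f * haar (\<lambda>x. of_real (h x)) - haar f * I (\<lambda>x. of_real (h x)))
         \<le> e * Re (haar (\<lambda>x. of_real (h x)))"
proof -
  obtain W W0 :: "'g set" where W: "open W" "0 \<in> W" "W \<subseteq> W0" and W0: "compact W0"
    using lc[unfolded locally_compact_space_def, rule_format, of 0] by auto
  define K1 where "K1 = (\<lambda>(z, w). z + w) ` (K \<times> W0)"
  have K1: "compact K1" unfolding K1_def case_prod_beta'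
    by (intro compact_continuous_image compact_Times K W0 continuous_on_add continuous_on_fst continuous_on_snd continuous_on_id)
  have in_K1: "z + w \<in> K1" if "z \<in> K" "w \<in> W0" for z w
    using that unfolding K1_def by force
  have KK1: "K \<subseteq> K1" using in_K1[of _ 0] W by auto
  define K2 where "K2 = (\<lambda>(w, z). - w + z) ` (W0 \<times> K)"
  have K2: "compact K2" unfolding K2_def case_prod_beta'
    by (intro compact_continuous_image compact_Times K W0 continuous_on_add continuous_on_minus
        continuous_on_fst continuous_on_snd continuous_on_id)
  have in_K2: "z \<in> K2" if "u \<in> W" "u + z \<in> K" for u z
  proof -
    have "z = - u + (u + z)" by simp
    then show ?thesis using that W(3) unfolding K2_def by (intro image_eqI[of _ _ "(u, u + z)"]) auto
  qed
  have KK2: "K \<subseteq> K2" using in_K2[of 0] W by auto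
  obtain C where C: "C > 0" "\<And>k e. k \<in> CC K1 \<Longrightarrow> (\<And>x. norm (k x) \<le> e) \<Longrightarrow> norm (I k) \<le> C * e"
    using I[unfolded invariant_functional_def, THEN conjunct2, THEN conjunct2, rule_format, OF K1] by blast
  have Ilin: "I (\<lambda>x. k x + c * l x) = I k + c * I l" if "k \<in> CC K1" "l \<in> CC K1" for k l c
    using I[unfolded invariant_functional_def, THEN conjunct1, rule_format, OF K1 that] .
  have Iinv: "I (\<lambda>x. k (a + x)) = I k" if "k \<in> CC W0" for k a
    using I[unfolded invariant_functional_def, THEN conjunct2, THEN conjunct1, rule_format, OF W0 that] .
  define r where "r = e / C"
  have r: "r > 0" "C * r = e" using e C(1) by (simp_all add: r_def)
  obtain U1 where U1: "open U1" "0 \<in> U1" "\<And>u x. u \<in> U1 \<Longrightarrow> norm (f (x + u) - f x) \<le> r"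
    using CC_right_uniform[OF f K r(1)] by blast
  have main: "norm (I f * haar (\<lambda>x. of_real (h x)) - haar f * I (\<lambda>x. of_real (h x)))
         \<le> e * Re (haar (\<lambda>x. of_real (h x)))"
    if bump_h: "bump (U1 \<inter> W) h" for h
  proof -
    have nn: "0 \<le> h x" and sym: "h (- x) = h x" and hU: "x \<notin> U1 \<inter> W \<Longrightarrow> h x = 0" for x
      using that by (simp_all add: bump_def)
    obtain L where hL: "(\<lambda>x. complex_of_real (h x)) \<in> CC L"
      using bump_h unfolding bump_def by blast
    define hc where "hc = (\<lambda>x. complex_of_real (h x))"
    have hc: "hc \<in> CC W0"
      unfolding CC_def using CC_cont[OF hL] W(3) hU by (auto simp: hc_def)
    define H where "H = Re (haar hc)"
    have haar_hc: "haar hc = of_real H"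
      unfolding H_def hc_def by (rule haar_of_real[OF hc[unfolded hc_def] W0])
    have slice: "(\<lambda>x. hc (- z + x)) \<in> CC K1" if "z \<in> K" for z
      by (rule CC_mono[OF CC_left_translate[OF hc, of "- z"]]) (use in_K1[OF that] in auto)
    have chc: "continuous_on UNIV (\<lambda>z. hc (- z + x))" for x
      by (intro continuous_on_compose2[OF CC_cont[OF hc]] continuous_on_add continuous_on_minus
          continuous_on_const continuous_on_id) simp
    define F where "F x = (\<lambda>z. f z * hc (- z + x))" for x
    have F: "F x \<in> CC K" for x
      using CC_mult[OF chc[of x] f] unfolding F_def by (simp add: mult.commute)
    have avg: "norm (haar (F x) - f x * haar hc) \<le> r * H" for x
    proof -
      have ct: "continuous_on UNIV (\<lambda>z. f (x + z))"
        by (rule continuous_on_translate[OF CC_cont[OF f]])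
      have "haar (\<lambda>z. F x (x + z)) = haar (F x)" by (rule haar_translate[OF F K])
      moreover have "F x (x + z) = f (x + z) * hc z" for z
        by (simp add: F_def hc_def minus_add add.assoc sym)
      ultimately have "haar (F x) = haar (\<lambda>z. f (x + z) * hc z)" by simp
      moreover have "haar (\<lambda>z. f (x + z) * hc z + (- f x) * hc z)
          = haar (\<lambda>z. f (x + z) * hc z) + (- f x) * haar hc"
        unfolding haar_add[OF CC_mult[OF ct hc] CC_scale[OF hc] W0] haar_scale[OF hc W0] ..
      ultimately have eq: "haar (F x) - f x * haar hc = haar (\<lambda>z. f (x + z) * hc z + (- f x) * hc z)"
        by simp
      have "norm (haar (\<lambda>z. f (x + z) * hc z + (- f x) * hc z)) \<le> Re (haar (\<lambda>z. of_real (r * h z)))"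
      proof (rule haar_mono[OF _ _ W0])
        show "(\<lambda>z. f (x + z) * hc z + (- f x) * hc z) \<in> CC W0"
          by (intro CC_add CC_mult[OF ct hc] CC_scale hc)
        show "(\<lambda>z. complex_of_real (r * h z)) \<in> CC W0"
          using CC_scale[OF hc, of "of_real r"] by (simp add: hc_def)
        show "norm (f (x + z) * hc z + (- f x) * hc z) \<le> r * h z" for z
        proof (cases "z \<in> U1")
          case True
          have "f (x + z) * hc z + (- f x) * hc z = (f (x + z) - f x) * hc z"
            by (simp add: algebra_simps)
          then show ?thesis
            using U1(3)[OF True, of x] nn[of z] by (simp add: norm_mult hc_def mult_right_mono)
        next
          case False
          then show ?thesis using hU[of z] by (simp add: hc_def)
        qed
      qed
      also have "Re (haar (\<lambda>z. of_real (r * h z))) = r * H"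
        using haar_scale[OF hc W0, of "of_real r"] by (simp add: H_def hc_def)
      finally show ?thesis unfolding eq .
    qed
    \<comment> \<open>The error \<open>\<delta>\<close> is that of the quadrature, whose nodes may depend on \<open>h\<close>; it tends to \<open>0\<close> for
      fixed \<open>h\<close>.\<close>
    have step: "norm (I f * haar hc - haar f * I hc) \<le> e * H + \<delta> * (C + norm (I hc))" if \<delta>: "\<delta> > 0" for \<delta>
    proof -
      obtain N where N: "N > 0" "\<And>k \<phi> c d x. k \<in> CC K2 \<Longrightarrow> (\<And>y. norm (k y) \<le> c) \<Longrightarrow>
         (\<And>\<gamma>. \<gamma> \<in> \<Gamma> \<Longrightarrow> norm (\<phi> \<gamma>) \<le> d) \<Longrightarrow> norm (spread k \<phi> x) \<le> N * (c * d)"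
        using spread_bound[OF K2] by metis
      have FF: "(\<lambda>p. F (snd p) (fst p)) \<in> CC (K \<times> K1)"
        unfolding CC_def
      proof (intro CollectI conjI allI impI)
        show "continuous_on UNIV (\<lambda>p. F (snd p) (fst p))"
          unfolding F_def
          by (intro continuous_on_mult continuous_on_compose2[OF CC_cont[OF f]] continuous_on_compose2[OF CC_cont[OF hc]]
              continuous_on_add continuous_on_minus continuous_on_fst continuous_on_snd continuous_on_id) auto
        fix p assume p: "p \<notin> K \<times> K1"
        show "F (snd p) (fst p) = 0"
        proof (cases "fst p \<in> K")
          case True
          then have "hc (- fst p + snd p) = 0" using CC_zero[OF slice] p by (auto simp: mem_Times_iff)
          then show ?thesis by (simp add: F_def)
        qed (simp add: F_def CC_zero[OF f])
      qed
      have \<delta>N: "\<delta> / N > 0" using \<delta> N(1) by simp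
      define G where "G = (\<lambda>p. F (snd p) (fst p))"
      have act: "continuous_on UNIV (\<lambda>(u, p :: 'g \<times> 'g). (u + fst p, snd p))"
        unfolding case_prod_beta'
        by (intro continuous_on_Pair continuous_on_add continuous_on_fst continuous_on_snd continuous_on_id)
      obtain V where V: "open V" "0 \<in> V"
        "\<And>u p. u \<in> V \<Longrightarrow> norm (G (u + fst p, snd p) - G p) \<le> \<delta> / N"
        by (rule CC_action_uniform[OF act _ _ FF[folded G_def] compact_Times[OF K K1] \<delta>N])
          (simp, simp, rule that)
      have V_le: "norm (F x (u + z) - F x z) \<le> \<delta> / N" if "u \<in> V" for u z x
        using V(3)[OF that, of "(z, x)"] by (simp add: G_def)
      have sF: "norm (spread (F x) (\<lambda>_. 1) (u + y) - spread (F x) (\<lambda>_. 1) y) \<le> \<delta>"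
        if u: "u \<in> V \<inter> W" for u x y
      proof -
        have 1: "(\<lambda>z. F x (u + z)) \<in> CC K2"
          by (rule CC_mono[OF CC_left_translate[OF F]]) (use in_K2 u in auto)
        have 2: "(\<lambda>z. (-1) * F x z) \<in> CC K2" by (intro CC_scale CC_mono[OF F KK2])
        have "spread (\<lambda>z. F x (u + z) + (-1) * F x z) (\<lambda>_. 1) y
            = spread (F x) (\<lambda>_. 1) (u + y) - spread (F x) (\<lambda>_. 1) y"
          unfolding spread_add_kernel[OF 1 2 K2] spread_scale_kernel[OF F K] spread_translate by simp
        moreover have "norm (spread (\<lambda>z. F x (u + z) + (-1) * F x z) (\<lambda>_. 1) y) \<le> N * (\<delta> / N * 1)"
          by (rule N(2)[OF CC_add[OF 1 2]]) (use V_le u in auto)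
        ultimately show ?thesis using N(1) by simp
      qed
      have sf: "spread f (\<lambda>_. 1) \<in> LUC"
        by (rule spread_LUC[OF f K, of _ 1]) simp
      obtain V' where V': "open V'" "0 \<in> V'"
        "\<And>u x. u \<in> V' \<Longrightarrow> norm (spread f (\<lambda>_. 1) (u + x) - spread f (\<lambda>_. 1) x) \<le> \<delta>"
        by (rule LUC_uniform[OF sf \<delta>]) (rule that)
      obtain A b where p: "partition (V \<inter> W \<inter> V') A b"
        by (rule partition_exists[of "V \<inter> W \<inter> V'"]) (use V(1,2) V'(1,2) W(1,2) in auto)
      have A: "finite A" using p by (simp add: partition_def)
      have q1: "norm (haar (F x) - (\<Sum>a\<in>A. haar (b a) * spread (F x) (\<lambda>_. 1) a)) \<le> \<delta>" for x
        unfolding haar_def[of "F x"]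
        by (rule quadrature[OF p periodic_spread[OF F K]]) (rule sF, simp)
      have q2: "norm (haar f - (\<Sum>a\<in>A. haar (b a) * spread f (\<lambda>_. 1) a)) \<le> \<delta>"
        unfolding haar_def[of f]
        by (rule quadrature[OF p periodic_spread[OF f K]]) (rule V'(3), simp)
      \<comment> \<open>\<open>S\<close> is the quadrature sum for the integral over \<open>y\<close>, expanded into translates of \<open>hc\<close>.\<close>
      define P where "P = Sigma A (\<lambda>a. {\<gamma>\<in>\<Gamma>. a + \<gamma> \<in> K})"
      have P: "finite P" unfolding P_def using A finite_fibre[OF K] by blast
      have sumP: "(\<Sum>p\<in>P. g (fst p) (snd p)) = (\<Sum>a\<in>A. \<Sum>\<gamma>\<in>{\<gamma>\<in>\<Gamma>. a + \<gamma> \<in> K}. g a \<gamma>)"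
        for g :: "'g \<Rightarrow> 'g \<Rightarrow> complex"
        unfolding P_def by (subst sum.Sigma) (auto simp: A finite_fibre[OF K] case_prod_beta')
      define S where "S x = (\<Sum>p\<in>P. haar (b (fst p)) * f (fst p + snd p) * hc (- (fst p + snd p) + x))" for x
      have S: "S x = (\<Sum>a\<in>A. haar (b a) * spread (F x) (\<lambda>_. 1) a)" for x
        unfolding S_def sumP[of "\<lambda>a \<gamma>. haar (b a) * f (a + \<gamma>) * hc (- (a + \<gamma>) + x)"]
          spread_fibre[OF F K] by (simp add: F_def sum_distrib_left mult.assoc)
      have PK: "fst p + snd p \<in> K" if "p \<in> P" for p using that by (auto simp: P_def)
      have IS: "S \<in> CC K1" "I S = (\<Sum>p\<in>P. haar (b (fst p)) * f (fst p + snd p) * I (\<lambda>x. hc (- (fst p + snd p) + x)))"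
        using invariant_functional_sum[OF I K1 P, of "\<lambda>p x. hc (- (fst p + snd p) + x)"
            "\<lambda>p. haar (b (fst p)) * f (fst p + snd p)"] slice PK unfolding S_def by blast+
      have IS': "I S = (\<Sum>a\<in>A. haar (b a) * spread f (\<lambda>_. 1) a) * I hc"
        unfolding IS(2) Iinv[OF hc] sumP[of "\<lambda>a \<gamma>. haar (b a) * f (a + \<gamma>) * I hc"]
        by (simp add: spread_fibre[OF f K] sum_distrib_left sum_distrib_right mult.assoc)
      have fK1: "f \<in> CC K1" by (rule CC_mono[OF f KK1])
      have T: "(\<lambda>x. (-1) * S x + haar hc * f x) \<in> CC K1"
        by (intro CC_add CC_scale IS fK1)
      have "norm (I (\<lambda>x. (-1) * S x + haar hc * f x)) \<le> C * (r * H + \<delta>)"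
      proof (rule C(2)[OF T])
        fix x
        have "(-1) * S x + haar hc * f x = (haar (F x) - S x) - (haar (F x) - f x * haar hc)"
          by (simp add: algebra_simps)
        then have "norm ((-1) * S x + haar hc * f x) \<le> norm (haar (F x) - S x) + norm (haar (F x) - f x * haar hc)"
          by (metis norm_triangle_ineq4)
        then show "norm ((-1) * S x + haar hc * f x) \<le> r * H + \<delta>"
          using avg[of x] q1[of x] unfolding S by linarith
      qed
      moreover have "I (\<lambda>x. (-1) * S x + haar hc * f x) = haar hc * I f - I S"
      proof -
        have z: "(\<lambda>x. 0) \<in> CC K1" by (simp add: CC_def)
        have "I (\<lambda>x. 0 + (-1) * S x) = I (\<lambda>x. 0) + (-1) * I S" by (rule Ilin[OF z IS(1)])
        moreover have "I (\<lambda>x. 0 + (-1) * 0) = I (\<lambda>x. 0) + (-1) * I (\<lambda>x. 0)" by (rule Ilin[OF z z])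
        ultimately have "I (\<lambda>x. (-1) * S x) = - I S" by simp
        then show ?thesis using Ilin[OF CC_scale[OF IS(1), of "-1"] fK1, of "haar hc"] by simp
      qed
      ultimately have n1: "norm (haar hc * I f - I S) \<le> C * (r * H + \<delta>)" by simp
      have n2: "norm (I S - haar f * I hc) \<le> \<delta> * norm (I hc)"
      proof -
        have "I S - haar f * I hc = - ((haar f - (\<Sum>a\<in>A. haar (b a) * spread f (\<lambda>_. 1) a)) * I hc)"
          unfolding IS' by (simp add: algebra_simps)
        then show ?thesis using q2 by (simp add: norm_mult mult_right_mono)
      qed
      have "norm (I f * haar hc - haar f * I hc) \<le> norm (haar hc * I f - I S) + norm (I S - haar f * I hc)"
        using norm_triangle_ineq[of "haar hc * I f - I S" "I S - haar f * I hc"] by (simp add: mult.commute)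
      also have "\<dots> \<le> C * (r * H + \<delta>) + \<delta> * norm (I hc)" using n1 n2 by linarith
      also have "\<dots> = e * H + \<delta> * (C + norm (I hc))" by (simp add: r(2)[symmetric] algebra_simps)
      finally show ?thesis .
    qed
    have "norm (I f * haar hc - haar f * I hc) \<le> e * H"
    proof (rule field_le_epsilon)
      fix t :: real assume "t > 0"
      moreover have pos: "C + norm (I hc) > 0" using C(1) by (simp add: add_pos_nonneg)
      ultimately have "t / (C + norm (I hc)) > 0" by simp
      from step[OF this] show "norm (I f * haar hc - haar f * I hc) \<le> e * H + t" using pos by simp
    qed
    then show ?thesis unfolding hc_def H_def .
  qed
  show thesis
    by (rule that[of "U1 \<inter> W"]) (use U1 W main in auto)
qed

text \<open>The comparison is made for \<open>f\<close> and for \<open>b\<close> with the same bump, whose unknown value under \<open>I\<close> is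
  then eliminated.\<close>

theorem haar_unique:
  assumes I: "invariant_functional I" and f: "f \<in> CC K" "compact K"
    and b: "b \<in> CC L" "compact L" "haar b = 1"
  shows "I f = I b * haar f"
proof -
  have "norm (I f - I b * haar f) \<le> 0"
  proof (rule field_le_epsilon)
    fix t :: real assume t: "t > 0"
    define e where "e = t / (1 + norm (haar f))"
    have e: "e > 0" "e * (1 + norm (haar f)) = t"
      using t by (simp_all add: e_def add_pos_nonneg add_nonneg_eq_0_iff)
    obtain U where U: "open U" "0 \<in> U" and Uf:
      "\<And>h. bump U h \<Longrightarrow> norm (I f * haar (\<lambda>x. of_real (h x)) - haar f * I (\<lambda>x. of_real (h x)))
         \<le> e * Re (haar (\<lambda>x. of_real (h x)))"
      by (rule haar_comparison[OF I f e(1)]) (rule that)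
    obtain V where V: "open V" "0 \<in> V" and Vb:
      "\<And>h. bump V h \<Longrightarrow> norm (I b * haar (\<lambda>x. of_real (h x)) - haar b * I (\<lambda>x. of_real (h x)))
         \<le> e * Re (haar (\<lambda>x. of_real (h x)))"
      by (rule haar_comparison[OF I b(1,2) e(1)]) (rule that)
    have UV: "open (U \<inter> V)" "0 \<in> U \<inter> V" using U V by auto
    obtain h :: "'g \<Rightarrow> real" and M where h: "compact M" "continuous_on UNIV h"
      "\<And>x. 0 \<le> h x" "h 0 = 1" "\<And>x. h (- x) = h x" "\<And>x. x \<notin> M \<Longrightarrow> h x = 0" "\<And>x. x \<notin> U \<inter> V \<Longrightarrow> h x = 0"
      by (rule symmetric_bump[OF lc UV]) (rule that)
    define hc where "hc = (\<lambda>x. complex_of_real (h x))"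
    have hM: "(\<lambda>x. of_real (h x)) \<in> CC M"
      using h(2,6) by (auto simp: CC_def intro: continuous_on_of_real)
    define H where "H = Re (haar hc)"
    have H: "H > 0" "haar hc = of_real H"
      unfolding H_def hc_def using haar_bump_pos[OF hM h(1,3,4,2)] haar_of_real[OF hM h(1)] by auto
    have 1: "norm (I f * haar hc - haar f * I hc) \<le> e * H"
      unfolding hc_def H_def by (rule Uf) (use h(1,3,5,7) hM in \<open>auto simp: bump_def\<close>)
    have 2: "norm (I b * haar hc - haar b * I hc) \<le> e * H"
      unfolding hc_def H_def by (rule Vb) (use h(1,3,5,7) hM in \<open>auto simp: bump_def\<close>)
    have "norm (I f - I b * haar f) * H = norm ((I f - I b * haar f) * haar hc)"
      using H by (simp add: norm_mult)
    also have "(I f - I b * haar f) * haar hc =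
        (I f * haar hc - haar f * I hc) - haar f * (I b * haar hc - haar b * I hc)"
      by (simp add: b(3) algebra_simps)
    also have "norm \<dots> \<le> norm (I f * haar hc - haar f * I hc)
        + norm (haar f) * norm (I b * haar hc - haar b * I hc)"
      using norm_triangle_ineq4 norm_mult by metis
    also have "\<dots> \<le> e * H + norm (haar f) * (e * H)"
      using 1 2 by (intro add_mono mult_left_mono) auto
    also have "\<dots> = t * H" by (simp add: e(2)[symmetric] algebra_simps)
    finally show "norm (I f - I b * haar f) \<le> 0 + t" using H(1) by simp
  qed
  then show ?thesis by simp
qed

section \<open>The map from means on the lattice\<close>

text \<open>This is \<open>P\<^sub>m f\<close>, as a periodic function on the group.\<close>

definition orbit_mean :: "(('g \<Rightarrow> complex) \<Rightarrow> complex) \<Rightarrow> ('g \<Rightarrow> complex) \<Rightarrow> 'g \<Rightarrow> complex" where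
  "orbit_mean m f x = m (\<lambda>\<gamma>\<in>\<Gamma>. f (x + \<gamma>))"

lemma iota_eq: "f \<in> LUC \<Longrightarrow> iota \<Gamma> \<nu> m f = coset_integral (orbit_mean m f)"
  by (simp add: iota_def coset_integral_def coset_mean_def orbit_mean_def Let_def)

lemma orbit_linf: "f \<in> LUC \<Longrightarrow> (\<lambda>\<gamma>\<in>\<Gamma>. f (x + \<gamma>)) \<in> linf \<Gamma>"
  by (erule LUC_bound) (rule linf_I, blast)

context
  fixes m
  assumes m: "m \<in> left_invariant_means \<Gamma> (linf \<Gamma>)"
begin

lemma m_mean: "is_mean \<Gamma> (linf \<Gamma>) m"
  and m_inv: "\<phi> \<in> linf \<Gamma> \<Longrightarrow> \<delta> \<in> \<Gamma> \<Longrightarrow> m (\<lambda>\<gamma>\<in>\<Gamma>. \<phi> (\<delta> + \<gamma>)) = m \<phi>"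
  using m by (auto simp: left_invariant_means_def left_invariant_on_def)

lemmas m_facts = mean_domain_linf[of \<Gamma>] m_mean

lemma orbit_mean_close:
  assumes f: "f \<in> LUC" and g: "g \<in> LUC" and le: "\<And>\<gamma>. \<gamma> \<in> \<Gamma> \<Longrightarrow> norm (f (x + \<gamma>) - g (y + \<gamma>)) \<le> e"
  shows "norm (orbit_mean m f x - orbit_mean m g y) \<le> 2 * e"
  unfolding orbit_mean_def
  by (rule mean_close[OF m_facts orbit_linf[OF f] orbit_linf[OF g]]) (simp add: le)

lemma orbit_mean_uniform:
  assumes f: "f \<in> LUC" and le: "\<And>x. norm (f (u + x) - f x) \<le> e"
  shows "norm (orbit_mean m f (u + x) - orbit_mean m f x) \<le> 2 * e"
  by (rule orbit_mean_close[OF f f]) (use le in \<open>simp add: add.assoc\<close>)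

text \<open>Periodicity is the left invariance of \<open>m\<close>; continuity holds because the left translates of \<open>f\<close>
  depend continuously, in the supremum norm, on the translating element.\<close>

lemma orbit_mean_periodic:
  assumes f: "f \<in> LUC"
  shows "orbit_mean m f \<in> periodic"
  unfolding periodic_def
proof (intro CollectI conjI allI ballI)
  show "continuous_on UNIV (orbit_mean m f)"
  proof (rule left_uniform_imp_continuous)
    fix e :: real assume "e > 0"
    then have "e / 2 > 0" by simp
    then obtain U where U: "open U" "0 \<in> U" "\<And>u x. u \<in> U \<Longrightarrow> norm (f (u + x) - f x) \<le> e / 2"
      by (rule LUC_uniform[OF f]) (rule that)
    have "norm (orbit_mean m f (u + x) - orbit_mean m f x) \<le> e" if "u \<in> U" for u x
      using orbit_mean_uniform[OF f, of u "e / 2" x] U(3)[OF that] by simp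
    then show "\<exists>U. open U \<and> 0 \<in> U \<and> (\<forall>u\<in>U. \<forall>x. norm (orbit_mean m f (u + x) - orbit_mean m f x) \<le> e)"
      using U(1,2) by blast
  qed
  fix x \<gamma> assume g: "\<gamma> \<in> \<Gamma>"
  have "(\<lambda>\<eta>\<in>\<Gamma>. f (x + \<gamma> + \<eta>)) = (\<lambda>\<eta>\<in>\<Gamma>. (\<lambda>\<eta>\<in>\<Gamma>. f (x + \<eta>)) (\<gamma> + \<eta>))"
    using add_in[OF g] by (auto simp: add.assoc)
  then show "orbit_mean m f (x + \<gamma>) = orbit_mean m f x"
    unfolding orbit_mean_def using m_inv[OF orbit_linf[OF f] g, of x] by simp
qed

lemma iota_in_LIM: "iota \<Gamma> \<nu> m \<in> left_invariant_means UNIV LUC"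
  unfolding left_invariant_means_def is_mean_def left_invariant_on_def restrict_UNIV
proof (intro CollectI conjI ballI allI impI)
  show "iota \<Gamma> \<nu> m \<in> extensional LUC" by (simp add: iota_def)
next
  fix f g :: "'g \<Rightarrow> complex" assume fg: "f \<in> LUC" "g \<in> LUC"
  have "orbit_mean m (\<lambda>x. f x + g x) = (\<lambda>x. orbit_mean m f x + orbit_mean m g x)"
  proof
    fix x
    have "(\<lambda>\<gamma>\<in>\<Gamma>. f (x + \<gamma>) + g (x + \<gamma>)) = (\<lambda>\<gamma>\<in>\<Gamma>. (\<lambda>\<gamma>\<in>\<Gamma>. f (x + \<gamma>)) \<gamma> + (\<lambda>\<gamma>\<in>\<Gamma>. g (x + \<gamma>)) \<gamma>)"
      by auto
    then show "orbit_mean m (\<lambda>x. f x + g x) x = orbit_mean m f x + orbit_mean m g x"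
      unfolding orbit_mean_def using mean_add[OF m_facts orbit_linf[OF fg(1)] orbit_linf[OF fg(2)]] by metis
  qed
  then show "iota \<Gamma> \<nu> m (\<lambda>x. f x + g x) = iota \<Gamma> \<nu> m f + iota \<Gamma> \<nu> m g"
    by (simp add: iota_eq fg LUC_add coset_integral_add orbit_mean_periodic)
next
  fix c and f :: "'g \<Rightarrow> complex" assume f: "f \<in> LUC"
  have "orbit_mean m (\<lambda>x. c * f x) = (\<lambda>x. c * orbit_mean m f x)"
  proof
    fix x
    have "(\<lambda>\<gamma>\<in>\<Gamma>. c * f (x + \<gamma>)) = (\<lambda>\<gamma>\<in>\<Gamma>. c * (\<lambda>\<gamma>\<in>\<Gamma>. f (x + \<gamma>)) \<gamma>)" by auto
    then show "orbit_mean m (\<lambda>x. c * f x) x = c * orbit_mean m f x"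
      unfolding orbit_mean_def using mean_scale[OF m_facts orbit_linf[OF f]] by metis
  qed
  then show "iota \<Gamma> \<nu> m (\<lambda>x. c * f x) = c * iota \<Gamma> \<nu> m f"
    by (simp add: iota_eq f LUC_scale coset_integral_scale)
next
  fix f :: "'g \<Rightarrow> complex" assume f: "f \<in> LUC" and nn: "\<forall>x\<in>UNIV. f x \<in> \<real>\<^sub>\<ge>\<^sub>0"
  have "orbit_mean m f x \<in> \<real>\<^sub>\<ge>\<^sub>0" for x
    unfolding orbit_mean_def by (rule mean_pos[OF m_facts orbit_linf[OF f]]) (use nn in simp)
  then show "iota \<Gamma> \<nu> m f \<in> \<real>\<^sub>\<ge>\<^sub>0"
    unfolding iota_eq[OF f] by (intro coset_integral_pos orbit_mean_periodic f)
next
  have "orbit_mean m (\<lambda>_. 1) = (\<lambda>_. 1)"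
    unfolding orbit_mean_def mean_one[OF m_facts] ..
  then show "iota \<Gamma> \<nu> m (\<lambda>x. 1) = 1"
    by (simp add: iota_eq LUC_const coset_integral_const)
next
  fix f :: "'g \<Rightarrow> complex" and a :: 'g assume f: "f \<in> LUC"
  have "orbit_mean m (\<lambda>y. f (a + y)) = (\<lambda>x. orbit_mean m f (a + x))"
    by (simp add: orbit_mean_def add.assoc fun_eq_iff)
  then show "iota \<Gamma> \<nu> m (\<lambda>y. f (a + y)) = iota \<Gamma> \<nu> m f"
    by (simp add: iota_eq f LUC_translate coset_integral_translate orbit_mean_periodic)
qed

end

section \<open>Surjectivity\<close>

text \<open>The mean \<open>m\<close> is read off from one kernel \<open>B\<close> with coset sums \<open>1\<close>. Uniqueness of the Haar integral
  makes the choice of \<open>B\<close> immaterial, which gives the invariance of \<open>m\<close> and also allows \<open>\<iota> m f\<close> to be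
  evaluated with another partition of unity, fine enough for \<open>f\<close>.\<close>

lemma iota_surj:
  assumes \<mu>: "\<mu> \<in> left_invariant_means UNIV LUC"
  shows "\<exists>m\<in>left_invariant_means \<Gamma> (linf \<Gamma>). iota \<Gamma> \<nu> m = \<mu>"
proof -
  have \<mu>_mean: "is_mean UNIV LUC \<mu>" and \<mu>_ext: "\<mu> \<in> extensional LUC"
    and \<mu>_inv: "\<And>f a. f \<in> LUC \<Longrightarrow> \<mu> (\<lambda>y. f (a + y)) = \<mu> f"
    using \<mu> by (auto simp: left_invariant_means_def left_invariant_on_def is_mean_def restrict_UNIV)
  note \<mu>_facts = mean_domain_LUC \<mu>_mean
  have spread_linf_LUC: "spread k \<phi> \<in> LUC" if "k \<in> CC K" "compact K" "\<phi> \<in> linf \<Gamma>" for k K \<phi>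
    by (rule linf_bound[OF that(3)]) (rule spread_LUC[OF that(1,2)])
  have func: "invariant_functional (\<lambda>k. \<mu> (spread k \<phi>))" if \<phi>: "\<phi> \<in> linf \<Gamma>" for \<phi>
    unfolding invariant_functional_def
  proof (intro conjI allI impI)
    fix K :: "'g set" and k l c assume K: "compact K" and k: "k \<in> CC K" and l: "l \<in> CC K"
    have "spread (\<lambda>x. k x + c * l x) \<phi> = (\<lambda>x. spread k \<phi> x + c * spread l \<phi> x)"
      by (rule ext) (simp only: spread_add_kernel[OF k CC_scale[OF l] K] spread_scale_kernel[OF l K])
    then show "\<mu> (spread (\<lambda>x. k x + c * l x) \<phi>) = \<mu> (spread k \<phi>) + c * \<mu> (spread l \<phi>)"
      using mean_add[OF \<mu>_facts spread_linf_LUC[OF k K \<phi>] LUC_scale[OF spread_linf_LUC[OF l K \<phi>]], of c]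
        mean_scale[OF \<mu>_facts spread_linf_LUC[OF l K \<phi>], of c] by (simp add: restrict_UNIV)
  next
    fix K :: "'g set" and k a assume "compact K" "k \<in> CC K"
    then show "\<mu> (spread (\<lambda>x. k (a + x)) \<phi>) = \<mu> (spread k \<phi>)"
      unfolding spread_translate[abs_def] by (intro \<mu>_inv spread_linf_LUC \<phi>)
  next
    fix K :: "'g set" assume K: "compact K"
    obtain d where d: "d > 0" "\<And>\<gamma>. \<gamma> \<in> \<Gamma> \<Longrightarrow> norm (\<phi> \<gamma>) \<le> d"
      by (rule linf_bound[OF \<phi>]) (rule that)
    obtain N where N: "N > 0" "\<And>k \<phi> c d x. k \<in> CC K \<Longrightarrow> (\<And>y. norm (k y) \<le> c) \<Longrightarrow>
         (\<And>\<gamma>. \<gamma> \<in> \<Gamma> \<Longrightarrow> norm (\<phi> \<gamma>) \<le> d) \<Longrightarrow> norm (spread k \<phi> x) \<le> N * (c * d)"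
      using spread_bound[OF K] by metis
    have "norm (\<mu> (spread k \<phi>)) \<le> 2 * N * d * e" if k: "k \<in> CC K" and e: "\<forall>x. norm (k x) \<le> e" for k e
    proof -
      have "norm (\<mu> (spread k \<phi>)) \<le> 2 * (N * (e * d))"
        by (rule mean_bound[OF \<mu>_facts spread_linf_LUC[OF k K \<phi>]]) (rule N(2)[OF k], use e d in auto)
      then show ?thesis by (simp add: algebra_simps)
    qed
    then show "\<exists>C>0. \<forall>k\<in>CC K. \<forall>e. (\<forall>x. norm (k x) \<le> e) \<longrightarrow> norm (\<mu> (spread k \<phi>)) \<le> C * e"
      using N(1) d(1) by (intro exI[of _ "2 * N * d"]) auto
  qed
  obtain A b where p: "partition UNIV A b"
    using partition_exists[of UNIV] by blast
  then have fin: "finite A" and nn: "\<And>a x. b a x \<in> \<real>\<^sub>\<ge>\<^sub>0"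
      and one: "\<And>x. (\<Sum>a\<in>A. spread (b a) (\<lambda>_. 1) x) = 1"
    by (simp_all add: partition_def)
  have "\<forall>a\<in>A. \<exists>K. compact K \<and> b a \<in> CC K" using p by (simp add: partition_def)
  then obtain K where K: "\<And>a. a \<in> A \<Longrightarrow> compact (K a)" "\<And>a. a \<in> A \<Longrightarrow> b a \<in> CC (K a)" by metis
  define B where "B x = (\<Sum>a\<in>A. b a x)" for x
  define L where "L = (\<Union>a\<in>A. K a)"
  have L: "compact L" unfolding L_def using fin K(1) by blast
  have bL: "b a \<in> CC L" if "a \<in> A" for a
    by (rule CC_mono[OF K(2)[OF that]]) (use that in \<open>auto simp: L_def\<close>)
  have B: "B \<in> CC L"
    using bL unfolding CC_def B_def by (auto intro!: continuous_on_sum sum.neutral)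
  have B_one: "spread B (\<lambda>_. 1) x = 1" for x
  proof -
    have "spread B (\<lambda>_. 1) x = (\<Sum>a\<in>A. spread (b a) (\<lambda>_. 1) x)"
      unfolding spread_fibre[OF B L] B_def
      by (simp add: spread_fibre[OF bL L]) (rule sum.swap)
    then show ?thesis using one by simp
  qed
  have B_nn: "B x \<in> \<real>\<^sub>\<ge>\<^sub>0" for x unfolding B_def using nn by (intro nonneg_Reals_sum_complex) auto
  have haar_B: "haar B = 1"
    unfolding haar_def B_one[abs_def] by (rule coset_integral_const)
  define m where "m = (\<lambda>\<phi>\<in>linf \<Gamma>. \<mu> (spread B \<phi>))"
  have m: "m \<phi> = \<mu> (spread B \<phi>)" if "\<phi> \<in> linf \<Gamma>" for \<phi> using that by (simp add: m_def)
  have key: "\<mu> (spread k \<phi>) = m \<phi> * haar k" if "\<phi> \<in> linf \<Gamma>" "k \<in> CC M" "compact M" for k M \<phi>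
    unfolding m[OF that(1)] by (rule haar_unique[OF func[OF that(1)] that(2,3) B L haar_B])
  have mean: "is_mean \<Gamma> (linf \<Gamma>) m"
    unfolding is_mean_def
  proof (intro conjI ballI allI impI)
    show "m \<in> extensional (linf \<Gamma>)" by (simp add: m_def)
  next
    fix \<phi> \<psi> :: "'g \<Rightarrow> complex" assume \<phi>: "\<phi> \<in> linf \<Gamma>" and \<psi>: "\<psi> \<in> linf \<Gamma>"
    have "(\<lambda>x\<in>\<Gamma>. \<phi> x + \<psi> x) \<in> linf \<Gamma>" by (rule mean_domain_add[OF mean_domain_linf \<phi> \<psi>])
    moreover have "spread B (\<lambda>x\<in>\<Gamma>. \<phi> x + \<psi> x) = (\<lambda>x. spread B \<phi> x + spread B \<psi> x)"
      unfolding spread_add[OF B L, symmetric] by (intro ext spread_cong) simp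
    ultimately show "m (\<lambda>x\<in>\<Gamma>. \<phi> x + \<psi> x) = m \<phi> + m \<psi>"
      using mean_add[OF \<mu>_facts spread_linf_LUC[OF B L \<phi>] spread_linf_LUC[OF B L \<psi>]] by (simp add: m \<phi> \<psi> restrict_UNIV)
  next
    fix c and \<phi> :: "'g \<Rightarrow> complex" assume \<phi>: "\<phi> \<in> linf \<Gamma>"
    have "(\<lambda>x\<in>\<Gamma>. c * \<phi> x) \<in> linf \<Gamma>" by (rule mean_domain_scale[OF mean_domain_linf \<phi>])
    moreover have "spread B (\<lambda>x\<in>\<Gamma>. c * \<phi> x) = (\<lambda>x. c * spread B \<phi> x)"
      unfolding spread_scale[OF B L, symmetric] by (intro ext spread_cong) simp
    ultimately show "m (\<lambda>x\<in>\<Gamma>. c * \<phi> x) = c * m \<phi>"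
      using mean_scale[OF \<mu>_facts spread_linf_LUC[OF B L \<phi>]] by (simp add: m \<phi> restrict_UNIV)
  next
    fix \<phi> :: "'g \<Rightarrow> complex" assume \<phi>: "\<phi> \<in> linf \<Gamma>" and pos: "\<forall>x\<in>\<Gamma>. \<phi> x \<in> \<real>\<^sub>\<ge>\<^sub>0"
    have "spread B \<phi> x \<in> \<real>\<^sub>\<ge>\<^sub>0" for x
      unfolding spread_fibre[OF B L]
      by (intro nonneg_Reals_sum_complex nonneg_Reals_mult_I B_nn) (use pos minus_in in auto)
    then show "m \<phi> \<in> \<real>\<^sub>\<ge>\<^sub>0"
      unfolding m[OF \<phi>] by (intro mean_pos[OF \<mu>_facts spread_linf_LUC[OF B L \<phi>]])
  next
    have "(\<lambda>x\<in>\<Gamma>. 1) \<in> linf \<Gamma>" by (rule mean_domain_one[OF mean_domain_linf])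
    moreover have "spread B (\<lambda>x\<in>\<Gamma>. 1) = (\<lambda>x. 1)"
      by (rule ext) (subst spread_cong[where \<psi> = "\<lambda>_. 1"], simp_all add: B_one)
    ultimately show "m (\<lambda>x\<in>\<Gamma>. 1) = 1"
      using mean_one[OF \<mu>_facts] by (simp add: m restrict_UNIV)
  qed
  have inv: "left_invariant_on \<Gamma> (linf \<Gamma>) m"
    unfolding left_invariant_on_def
  proof (intro ballI)
    fix \<phi> \<delta> assume \<phi>: "\<phi> \<in> linf \<Gamma>" and d: "\<delta> \<in> \<Gamma>"
    obtain c where "\<And>\<gamma>. \<gamma> \<in> \<Gamma> \<Longrightarrow> norm (\<phi> \<gamma>) \<le> c"
      by (rule linf_bound[OF \<phi>]) (rule that)
    then have lin: "(\<lambda>\<gamma>\<in>\<Gamma>. \<phi> (\<delta> + \<gamma>)) \<in> linf \<Gamma>"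
      by (intro linf_I[of _ _ c]) (simp add: add_in d)
    have BR: "(\<lambda>x. B (x + \<delta>)) \<in> CC ((\<lambda>x. x + - \<delta>) ` L)" "compact ((\<lambda>x. x + - \<delta>) ` L)"
      by (rule CC_right_translate[OF B], rule compact_translate[OF L])
    have "spread B (\<lambda>\<gamma>\<in>\<Gamma>. \<phi> (\<delta> + \<gamma>)) = spread (\<lambda>x. B (x + \<delta>)) \<phi>"
      unfolding spread_shift[OF d, abs_def, symmetric] by (intro ext spread_cong) simp
    then have "m (\<lambda>\<gamma>\<in>\<Gamma>. \<phi> (\<delta> + \<gamma>)) = m \<phi> * haar (\<lambda>x. B (x + \<delta>))"
      unfolding m[OF lin] using key[OF \<phi> BR] by simp
    moreover have "spread (\<lambda>x. B (x + \<delta>)) (\<lambda>_. 1) = (\<lambda>x. 1)"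
      by (rule ext) (simp add: spread_shift[OF d, of B "\<lambda>_. 1", symmetric] B_one)
    then have "haar (\<lambda>x. B (x + \<delta>)) = 1"
      unfolding haar_def by (simp add: coset_integral_const)
    ultimately show "m (\<lambda>\<gamma>\<in>\<Gamma>. \<phi> (\<delta> + \<gamma>)) = m \<phi>" by simp
  qed
  have m_LIM: "m \<in> left_invariant_means \<Gamma> (linf \<Gamma>)"
    using mean inv by (simp add: left_invariant_means_def)
  have "iota \<Gamma> \<nu> m f = \<mu> f" if f: "f \<in> LUC" for f
  proof -
    have "norm (iota \<Gamma> \<nu> m f - \<mu> f) \<le> 0"
    proof (rule field_le_epsilon)
      fix t :: real assume "t > 0"
      then have t: "t / 4 > 0" by simp
      obtain U where U: "open U" "0 \<in> U" "\<And>u x. u \<in> U \<Longrightarrow> norm (f (u + x) - f x) \<le> t / 4"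
        by (rule LUC_uniform[OF f t]) (rule that)
      obtain A b where p: "partition U A b" by (rule partition_exists[OF U(1,2)])
      then have fin: "finite A" and "\<forall>a\<in>A. \<exists>K. compact K \<and> b a \<in> CC K"
        by (simp_all add: partition_def)
      then obtain K where K: "\<And>a. a \<in> A \<Longrightarrow> compact (K a)" "\<And>a. a \<in> A \<Longrightarrow> b a \<in> CC (K a)" by metis
      define \<phi> where "\<phi> a = (\<lambda>\<gamma>\<in>\<Gamma>. f (a + \<gamma>))" for a
      have \<phi>: "\<phi> a \<in> linf \<Gamma>" for a unfolding \<phi>_def by (rule orbit_linf[OF f])
      define S where "S = (\<Sum>a\<in>A. haar (b a) * m (\<phi> a))"
      have 1: "norm (iota \<Gamma> \<nu> m f - S) \<le> 2 * (t / 4)"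
        unfolding iota_eq[OF f] S_def \<phi>_def orbit_mean_def[symmetric]
        by (rule quadrature[OF p orbit_mean_periodic[OF m_LIM f]])
          (rule orbit_mean_uniform[OF m_LIM f U(3)])
      have LUCs: "spread (b a) (\<phi> a) \<in> LUC" if "a \<in> A" for a
        by (rule spread_linf_LUC[OF K(2,1) \<phi>]) (use that in auto)
      have R: "(\<lambda>x. \<Sum>a\<in>A. spread (b a) (\<phi> a) x) \<in> LUC"
        "\<mu> (\<lambda>x. \<Sum>a\<in>A. spread (b a) (\<phi> a) x) = (\<Sum>a\<in>A. \<mu> (spread (b a) (\<phi> a)))"
        using mean_sum[OF \<mu>_facts fin, of "\<lambda>a. spread (b a) (\<phi> a)"] LUCs by (simp_all add: restrict_UNIV)
      have "(\<Sum>a\<in>A. \<mu> (spread (b a) (\<phi> a))) = S"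
        unfolding S_def
      proof (rule sum.cong[OF refl])
        fix a assume "a \<in> A"
        from key[OF \<phi> K(2)[OF this] K(1)[OF this]]
        show "\<mu> (spread (b a) (\<phi> a)) = haar (b a) * m (\<phi> a)" by simp
      qed
      moreover have "norm (\<mu> f - \<mu> (\<lambda>x. \<Sum>a\<in>A. spread (b a) (\<phi> a) x)) \<le> 2 * (t / 4)"
      proof (rule mean_close[OF \<mu>_facts f R(1)])
        fix x
        show "norm (f x - (\<Sum>a\<in>A. spread (b a) (\<phi> a) x)) \<le> t / 4"
        proof (rule partition_approx[OF p])
          fix a \<gamma> assume g: "\<gamma> \<in> \<Gamma>" "x + \<gamma> - a \<in> U"
          have "(x + \<gamma> - a) + (a - \<gamma>) = x" by (simp add: add.assoc diff_conv_add_uminus del: add_uminus_conv_diff)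
          then show "norm (f x - \<phi> a (- \<gamma>)) \<le> t / 4"
            using U(3)[OF g(2), of "a - \<gamma>"] minus_in[OF g(1)] by (simp add: \<phi>_def)
        qed
      qed
      ultimately have 2: "norm (\<mu> f - S) \<le> 2 * (t / 4)" using R(2) by simp
      have "norm (iota \<Gamma> \<nu> m f - \<mu> f) \<le> norm (iota \<Gamma> \<nu> m f - S) + norm (\<mu> f - S)"
        using norm_triangle_ineq4[of "iota \<Gamma> \<nu> m f - S" "\<mu> f - S"] by simp
      then show "norm (iota \<Gamma> \<nu> m f - \<mu> f) \<le> 0 + t" using 1 2 by linarith
    qed
    then show ?thesis by simp
  qed
  then have "iota \<Gamma> \<nu> m = \<mu>"
    by (intro extensionalityI[of _ LUC] \<mu>_ext) (auto simp: iota_def)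
  with m_LIM show ?thesis by blast
qed

end

section \<open>Topological left-invariant means on left uniformly continuous functions\<close>

lemma open_left_translate:
  fixes U :: "'g::topological_group_add set"
  assumes "open U"
  shows "open ((+) a ` U)"
proof -
  have "(+) a ` U = (\<lambda>y. - a + y) -` U"
    by (auto intro: rev_image_eqI)
  then show ?thesis
    using open_vimage[OF assms, of "\<lambda>y. - a + y"]
    by (simp add: continuous_on_add continuous_on_const continuous_on_id)
qed

text \<open>Invariance under convolution is turned into invariance under translation: to translate a
  convolution on the left is to translate its density, and the translated density again has
  integral \<open>1\<close>.\<close>

lemma TLIM_restrict:
  fixes H :: "'g::{topological_group_add,t2_space} measure"
  assumes lc: "locally_compact_space (euclidean :: 'g topology)"
    and H: "left_haar_measure H" and \<mu>: "\<mu> \<in> TLIM H"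
  shows "restrict \<mu> LUC \<in> left_invariant_means UNIV LUC"
proof -
  have radon: "radon_measure euclidean H" and nz: "emeasure H UNIV \<noteq> 0"
    and inv: "\<And>x B. B \<in> sets H \<Longrightarrow> emeasure H ((+) x ` B) = emeasure H B"
    using H by (auto simp: left_haar_measure_def)
  have space_H: "space H = UNIV" and compact_finite: "\<And>K. compact K \<Longrightarrow> emeasure H K < \<infinity>"
    and inner: "\<And>U. open U \<Longrightarrow> emeasure H U = (SUP K\<in>{K. compact K \<and> K \<subseteq> U}. emeasure H K)"
    using radon by (auto simp: radon_measure_def)
  have sets_H: "sets H = sets borel"
    using radon by (simp add: radon_measure_def borel_def)
  have cont_meas: "f \<in> borel_measurable H" if "continuous_on UNIV f" for f :: "'g \<Rightarrow> complex"
    using borel_measurable_continuous_onI[OF that] measurable_cong_sets[OF sets_H refl] by blast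
  have LUC_Linf: "LUC \<subseteq> Linf H"
    using cont_meas by (auto simp: Linf_def LUC_def intro: measurable_restrict_space1)
  have \<mu>_mean: "is_mean UNIV (Linf H) \<mu>"
    and \<mu>_conv: "\<And>\<phi> f. \<phi> \<in> Linf H \<Longrightarrow> integrable H f \<Longrightarrow> (\<And>y. 0 \<le> f y) \<Longrightarrow> integral\<^sup>L H f = 1
        \<Longrightarrow> \<mu> (convolution H f \<phi>) = \<mu> \<phi>"
    using \<mu> by (auto simp: TLIM_def is_mean_Linf_def)
  have mean: "is_mean UNIV LUC (restrict \<mu> LUC)"
    using \<mu>_mean LUC_Linf unfolding is_mean_def restrict_UNIV
    by (auto simp: LUC_add LUC_scale LUC_const subset_iff)
  have open_pos: "emeasure H U \<noteq> 0" if U: "open U" "0 \<in> U" for U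
  proof
    assume z: "emeasure H U = 0"
    have null: "emeasure H K = 0" if K: "compact K" for K
    proof -
      have o: "open ((+) x ` U)" for x by (rule open_left_translate[OF U(1)])
      have "K \<subseteq> (\<Union>x\<in>K. (+) x ` U)" using U(2) by force
      then obtain A where A: "A \<subseteq> K" "finite A" "K \<subseteq> (\<Union>x\<in>A. (+) x ` U)"
        using compactE_image[OF K, of K "\<lambda>x. (+) x ` U"] o by metis
      have S: "(+) x ` U \<in> sets H" for x unfolding sets_H using o by simp
      have "emeasure H K \<le> emeasure H (\<Union>x\<in>A. (+) x ` U)"
        by (rule emeasure_mono[OF A(3)]) (use A(2) S in blast)
      also have "\<dots> \<le> (\<Sum>x\<in>A. emeasure H ((+) x ` U))"
        by (rule emeasure_subadditive_finite[OF A(2)]) (use S in blast)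
      also have "\<dots> = 0" using inv[of U] z U(1) by (simp add: sets_H)
      finally show ?thesis by simp
    qed
    have "emeasure H UNIV = 0"
      unfolding inner[OF open_UNIV] using null by (auto simp: SUP_eq_iff intro!: antisym SUP_least)
    then show False using nz by blast
  qed
  have translate: "(LINT y|H. g (a + y)) = (LINT y|H. g y)" if g: "g \<in> borel_measurable H" for g :: "'g \<Rightarrow> complex" and a
  proof -
    have m: "(+) a \<in> measurable H H"
    proof -
      have "(+) a \<in> measurable borel borel"
        by (rule borel_measurable_continuous_onI)
          (intro continuous_on_add continuous_on_const continuous_on_id)
      then show ?thesis using measurable_cong_sets[OF sets_H sets_H] by blast
    qed
    have "distr H H ((+) a) = H"
    proof (rule measure_eqI)
      fix B assume "B \<in> sets (distr H H ((+) a))"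
      then have B: "B \<in> sets H" by simp
      have pre: "(+) a -` B \<inter> space H \<in> sets H" by (rule measurable_sets[OF m B])
      have "(+) a ` ((+) a -` B \<inter> space H) = B"
      proof
        show "B \<subseteq> (+) a ` ((+) a -` B \<inter> space H)"
        proof
          fix y assume "y \<in> B"
          then have "- a + y \<in> (+) a -` B \<inter> space H" by (simp add: space_H)
          then show "y \<in> (+) a ` ((+) a -` B \<inter> space H)" by (rule rev_image_eqI) simp
        qed
      qed auto
      then show "emeasure (distr H H ((+) a)) B = emeasure H B"
        using emeasure_distr[OF m B] inv[OF pre, of a] by simp
    qed simp
    then show ?thesis using integral_distr[OF m g] by simp
  qed
  obtain W W0 :: "'g set" where W: "open W" "0 \<in> W" "W \<subseteq> W0" and W0: "compact W0"
    using lc[unfolded locally_compact_space_def, rule_format, of 0] by auto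
  have inv\<mu>: "\<mu> (\<lambda>x. \<phi> (a + x)) = \<mu> \<phi>" if \<phi>: "\<phi> \<in> LUC" for \<phi> a
  proof -
    have "norm (\<mu> (\<lambda>x. \<phi> (a + x)) - \<mu> \<phi>) \<le> 0"
    proof (rule field_le_epsilon)
      fix t :: real assume "t > 0"
      then have t: "t / 2 > 0" by simp
      obtain c where c: "c > 0" "\<And>x. norm (\<phi> x) \<le> c" by (rule LUC_bound[OF \<phi>]) (rule that)
      obtain U where U: "open U" "0 \<in> U" "\<And>u x. u \<in> U \<Longrightarrow> norm (\<phi> (u + x) - \<phi> x) \<le> t / 2"
        by (rule LUC_uniform[OF \<phi> t]) (rule that)
      \<comment> \<open>The convolution evaluates \<open>\<phi>\<close> at \<open>- y + x\<close>, hence the reflection of \<open>U\<close>.\<close>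
      define E where "E = W \<inter> (\<lambda>u. - u) -` U"
      have oU: "open ((\<lambda>u. - u) -` U)"
        by (intro open_vimage[OF U(1)] continuous_on_minus continuous_on_id)
      have E: "open E" "0 \<in> E" unfolding E_def using W U(2) oU by auto
      have Es: "E \<in> sets H" unfolding sets_H using E(1) by simp
      have W0s: "W0 \<in> sets H"
        unfolding sets_H using compact_imp_closed[OF W0] by simp
      have "emeasure H E \<le> emeasure H W0"
        by (rule emeasure_mono[OF _ W0s]) (use W(3) in \<open>auto simp: E_def\<close>)
      then have fin: "emeasure H E < \<infinity>" using compact_finite[OF W0] by simp
      define v where "v = measure H E"
      have v: "v > 0"
        unfolding v_def using open_pos[OF E] fin
        by (simp add: measure_def enn2real_positive_iff zero_less_iff_neq_zero)
      define g where "g y = indicator E y / v" for y :: 'g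
      have g_int: "integrable H g"
        unfolding g_def by (intro integrable_divide_zero integrable_real_indicator Es fin)
      have g_nn: "0 \<le> g y" for y unfolding g_def using v by simp
      have g_one: "integral\<^sup>L H g = 1"
        unfolding g_def using v by (simp add: v_def space_H)
      define C where "C = convolution H g \<phi>"
      have C: "\<mu> C = \<mu> \<phi>"
        unfolding C_def using \<mu>_conv[OF _ g_int g_nn g_one] \<phi> LUC_Linf by blast
      have cont: "continuous_on UNIV (\<lambda>y. \<phi> (- y + x))" for x
        by (intro continuous_on_compose2[OF LUC_cont[OF \<phi>]] continuous_on_add continuous_on_minus
            continuous_on_const continuous_on_id) simp
      have g_meas': "(\<lambda>y. complex_of_real (g y)) \<in> borel_measurable H"
        by (rule borel_measurable_integrable[OF integrable_of_real[OF g_int]])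
      have integ: "integrable H (\<lambda>y. of_real (g y) * \<psi> y)"
        if \<psi>: "continuous_on UNIV \<psi>" "\<And>y. norm (\<psi> y) \<le> d" for \<psi> :: "'g \<Rightarrow> complex" and d
      proof (rule Bochner_Integration.integrable_bound[of H "\<lambda>y. d * g y"])
        show "integrable H (\<lambda>y. d * g y)" using g_int by simp
        show "(\<lambda>y. of_real (g y) * \<psi> y) \<in> borel_measurable H"
          by (rule borel_measurable_times[OF g_meas' cont_meas[OF \<psi>(1)]])
        show "AE y in H. norm (of_real (g y) * \<psi> y) \<le> norm (d * g y)"
          using \<psi>(2) g_nn order_trans[OF norm_ge_zero \<psi>(2)]
          by (intro AE_I2) (simp add: norm_mult mult.commute[of "g _"] mult_right_mono)
      qed
      have avg: "norm ((LINT y|H. of_real (g y) * \<psi> y) - z) \<le> r"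
        if \<psi>: "continuous_on UNIV \<psi>" "\<And>y. norm (\<psi> y) \<le> d" and r: "\<And>y. y \<in> E \<Longrightarrow> norm (\<psi> y - z) \<le> r"
        for \<psi> :: "'g \<Rightarrow> complex" and d z r
      proof -
        have i2: "integrable H (\<lambda>y. of_real (g y) * z)"
          by (intro integrable_mult_left integrable_of_real g_int)
        have "(LINT y|H. of_real (g y) * z) = z"
          using g_one by simp
        then have "(LINT y|H. of_real (g y) * \<psi> y) - z = (LINT y|H. of_real (g y) * \<psi> y - of_real (g y) * z)"
          using Bochner_Integration.integral_diff[OF integ[OF \<psi>] i2] by simp
        also have "norm \<dots> \<le> (LINT y|H. norm (of_real (g y) * \<psi> y - of_real (g y) * z))"
          by (rule integral_norm_bound)
        also have "\<dots> \<le> (LINT y|H. g y * r)"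
        proof (rule integral_mono)
          show "integrable H (\<lambda>y. norm (of_real (g y) * \<psi> y - of_real (g y) * z))"
            by (intro integrable_norm Bochner_Integration.integrable_diff integ[OF \<psi>] i2)
          show "integrable H (\<lambda>y. g y * r)" using g_int by simp
          fix y
          have "norm (of_real (g y) * \<psi> y - of_real (g y) * z) = g y * norm (\<psi> y - z)"
            unfolding right_diff_distrib[symmetric] norm_mult using g_nn[of y] by simp
          also have "\<dots> \<le> g y * r"
            using r[of y] v by (cases "y \<in> E") (auto simp: g_def divide_right_mono)
          finally show "norm (of_real (g y) * \<psi> y - of_real (g y) * z) \<le> g y * r" .
        qed
        also have "\<dots> = r" using g_one by simp
        finally show ?thesis .
      qed
      have C_close: "norm (C x - \<phi> x) \<le> t / 2" for x
        unfolding C_def convolution_def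
      proof (rule avg[OF cont c(2)])
        fix y assume "y \<in> E"
        then show "norm (\<phi> (- y + x) - \<phi> x) \<le> t / 2" using U(3)[of "- y" x] by (simp add: E_def)
      qed
      have C_LUC: "C \<in> LUC"
      proof (rule LUC_I)
        show "norm (C x) \<le> t / 2 + c" for x
        proof -
          have "norm (C x) \<le> norm (C x - \<phi> x) + norm (\<phi> x)"
            by (metis diff_add_cancel norm_triangle_ineq)
          then show ?thesis using C_close[of x] c(2)[of x] by linarith
        qed
        fix e :: real assume e: "e > 0"
        obtain V where V: "open V" "0 \<in> V" "\<And>u x. u \<in> V \<Longrightarrow> norm (\<phi> (u + x) - \<phi> x) \<le> e"
          by (rule LUC_uniform[OF \<phi> e]) (rule that)
        obtain V' where V': "open V'" "0 \<in> V'" "\<And>u y. u \<in> V' \<Longrightarrow> y \<in> W0 \<Longrightarrow> - y + u + y \<in> V"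
          by (rule conjugates_small[OF W0 V(1,2)]) (rule that)
        \<comment> \<open>Moving \<open>x\<close> by \<open>u\<close> moves \<open>- y + x\<close> by the conjugate of \<open>u\<close> by \<open>y\<close>, and \<open>y\<close> ranges over a
          relatively compact set.\<close>
        have "norm (C (u + x) - C x) \<le> e" if u: "u \<in> V'" for u x
        proof -
          have "C (u + x) - C x = (LINT y|H. of_real (g y) * (\<phi> (- y + (u + x)) - \<phi> (- y + x)))"
            unfolding C_def convolution_def right_diff_distrib
            by (rule Bochner_Integration.integral_diff[symmetric, OF integ[OF cont c(2)] integ[OF cont c(2)]])
          moreover have "norm ((LINT y|H. of_real (g y) * (\<phi> (- y + (u + x)) - \<phi> (- y + x))) - 0) \<le> e"
          proof (rule avg[where d = "c + c"])
            show "continuous_on UNIV (\<lambda>y. \<phi> (- y + (u + x)) - \<phi> (- y + x))"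
              by (intro continuous_on_diff cont)
            show "norm (\<phi> (- y + (u + x)) - \<phi> (- y + x)) \<le> c + c" for y
              using c(2)[of "- y + (u + x)"] c(2)[of "- y + x"]
                norm_triangle_ineq4[of "\<phi> (- y + (u + x))" "\<phi> (- y + x)"] by linarith
            fix y assume "y \<in> E"
            then have "- y + u + y \<in> V" using V'(3)[OF u] W(3) by (auto simp: E_def)
            from V(3)[OF this, of "- y + x"]
            show "norm (\<phi> (- y + (u + x)) - \<phi> (- y + x) - 0) \<le> e" by (simp add: add.assoc)
          qed
          ultimately show ?thesis by simp
        qed
        then show "\<exists>U. open U \<and> 0 \<in> U \<and> (\<forall>u\<in>U. \<forall>x. norm (C (u + x) - C x) \<le> e)"
          using V'(1,2) by blast
      qed
      have Ca: "\<mu> (\<lambda>x. C (a + x)) = \<mu> \<phi>"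
      proof -
        have "C (a + x) = convolution H (\<lambda>y. g (a + y)) \<phi> x" for x
        proof -
          have "(\<lambda>y. of_real (g y) * \<phi> (- y + (a + x))) \<in> borel_measurable H"
            by (rule borel_measurable_integrable[OF integ[OF cont c(2)]])
          from translate[OF this, of a] show ?thesis
            unfolding C_def convolution_def
            by (simp add: minus_add add.assoc diff_conv_add_uminus del: add_uminus_conv_diff)
        qed
        then have "(\<lambda>x. C (a + x)) = convolution H (\<lambda>y. g (a + y)) \<phi>" by blast
        moreover have "\<mu> (convolution H (\<lambda>y. g (a + y)) \<phi>) = \<mu> \<phi>"
        proof (rule \<mu>_conv)
          show "\<phi> \<in> Linf H" using \<phi> LUC_Linf by blast
          have "(+) (- a) ` E \<in> sets H"
            unfolding sets_H using open_left_translate[OF E(1), of "- a"] by simp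
          moreover have "g (a + y) = indicator ((+) (- a) ` E) y / v" for y
            unfolding g_def by (auto simp: indicator_def intro: rev_image_eqI)
          moreover have "emeasure H ((+) (- a) ` E) < \<infinity>" using inv[OF Es, of "- a"] fin by simp
          ultimately show "integrable H (\<lambda>y. g (a + y))"
            by (simp add: integrable_real_indicator)
          have "(LINT y|H. complex_of_real (g (a + y))) = (LINT y|H. complex_of_real (g y))"
            by (rule translate[OF g_meas'])
          then have "complex_of_real (LINT y|H. g (a + y)) = complex_of_real (LINT y|H. g y)"
            by simp
          then show "(LINT y|H. g (a + y)) = 1"
            using g_one by (simp only: of_real_eq_iff)
        qed (rule g_nn)
        ultimately show ?thesis by simp
      qed
      let ?\<rho> = "restrict \<mu> LUC"
      have "norm (?\<rho> (\<lambda>x. \<phi> (a + x)) - ?\<rho> (\<lambda>x. C (a + x))) \<le> 2 * (t / 2)"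
        by (rule mean_close[OF mean_domain_LUC mean LUC_translate[OF \<phi>] LUC_translate[OF C_LUC]])
          (use C_close in \<open>simp add: norm_minus_commute\<close>)
      then show "norm (\<mu> (\<lambda>x. \<phi> (a + x)) - \<mu> \<phi>) \<le> 0 + t"
        using Ca by (simp add: LUC_translate[OF \<phi>] LUC_translate[OF C_LUC])
    qed
    then show ?thesis by simp
  qed
  have "left_invariant_on UNIV LUC (restrict \<mu> LUC)"
    unfolding left_invariant_on_def restrict_UNIV by (simp add: LUC_translate inv\<mu>)
  with mean show ?thesis by (simp add: left_invariant_means_def)
qed

section \<open>Lattice means induce all topological left-invariant means\<close>

theorem theoremV16:
  fixes H :: "'g::{topological_group_add,t2_space} measure"
    and \<Gamma> :: "'g set"
    and \<nu> :: "'g set measure"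
  assumes "locally_compact_space (euclidean :: 'g topology)"
    and "left_haar_measure H"
    and "amenable H"
    and "uniform_lattice \<Gamma>"
    and "invariant_radon_probability \<Gamma> \<nu>"
  shows "iota \<Gamma> \<nu> ` left_invariant_means \<Gamma> (linf \<Gamma>) = left_invariant_means UNIV LUC \<and>
    (\<forall>\<mu>\<in>TLIM H. \<exists>m\<in>left_invariant_means \<Gamma> (linf \<Gamma>). iota \<Gamma> \<nu> m = restrict \<mu> LUC)"
proof -
  interpret lattice_setting \<Gamma> \<nu> by unfold_locales fact+
  show ?thesis
    using iota_in_LIM iota_surj TLIM_restrict[OF assms(1,2)] by fast
qed

end
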